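(* Let $A=\begin{pmatrix}a&b\\c&d\end{pmatrix}\in SL(2,\mathbb{Z})$, let $\lambda_1,\lambda_2\in\mathbb{C}^*$ satisfy $\lambda_1=\lambda_1^a\lambda_2^b$ and $\lambda_2=\lambda_1^c\lambda_2^d$, and let $u,v\in\mathbb{C}$ with $u^n=-\lambda_1$, $v^n=-\lambda_2$. Let $(r_k)_{k\in\mathbb{Z}/n}$ be the sequence defined in the context, and let $\overline{\Lambda}_n\in\mathrm{End}(V)$ be given by $\overline{\Lambda}_n(e_t)=\sum_{0\le k\le n-1}(\overline{\Lambda}_n)_{k,t}\,e_k$ for all $0\le t\le n-1$, where $$(\overline{\Lambda}_n)_{k,t}=r_{k-td}\,(v^{d-1}u^{c})^t\,q^{c(tk-dt^2/2)} .$$ Then $\overline{\Lambda}_n$ is an intertwiner between $\rho_{u,v}$ and $\rho_{u,v}F_{A,+}$: it is invertible and $\rho_{u,v}F_{A,+}(Z)=\overline{\Lambda}_n\,\rho_{u,v}(Z)\,\overline{\Lambda}_n^{-1}$ for all $Z\in\mathbb{C}[X^{\pm1},Y^{\pm1}]_{q^{1/2}}$.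
   Context: Let $n\ge1$ be odd and $q^{1/2}\in\mathbb{C}$ with $(q^{1/2})^n=-1$ and $q=(q^{1/2})^2$ a primitive $n$-th root of unity; $q^{x/2}=(q^{1/2})^x$ for $x\in\mathbb{Z}$. $\mathbb{C}[X^{\pm1},Y^{\pm1}]_{q^{1/2}}$ is the algebra generated by $X^{\pm1},Y^{\pm1}$ with $XY=qYX$; $\theta_{(k,l)}=q^{-kl/2}X^kY^l$; $F_{A,+}$ is the algebra automorphism $\theta_{(k,l)}\mapsto\theta_{(k,l)A}$ (row vector times matrix). $V$ has basis $e_0,\dots,e_{n-1}$ (indices mod $n$), and $\rho_{u,v}(X)e_i=uq^ie_i$, $\rho_{u,v}(Y)e_i=ve_{i+1}$. Definition of $r_k$: let $m=\gcd(b,n)$ (with $\gcd(0,n)=n$) and $n=n'm$. There is a unique integer $0\le k_0\le m-1$ such that $\left(v^{n'b}u^{n'(a-1)}q^{ab(n')^2/2}\right)q^{an'k_0}=1$. Set $r_{k_0}=1$ and $r_k=0$ for $0\le k\le m-1$, $k\ne k_0$, and define, with all indices modulo $n$, $$r_{k+tb}=r_k\,v^{tb}u^{t(a-1)}q^{a(tk+bt^2/2)},\qquad 0\le k\le m-1,\ t\in\mathbb{Z}.$$ This is well defined and defines $r_k$ for every index modulo $n$. *)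

theory Defs
  imports
    "HOL-Library.Poly_Mapping"
    "Jordan_Normal_Form.Matrix"
begin

text \<open>
  The square root of the parameter, \<open>q\<^sup>1\<^sup>/\<^sup>2\<close>, is written \<open>qh\<close>, so that \<open>q = qh\<^sup>2\<close> and
  \<open>q\<^sup>x\<^sup>/\<^sup>2 = qh powi x\<close>.

  The algebra generated by \<open>X\<close>, \<open>Y\<close> and their inverses subject to \<open>X Y = q Y X\<close> is represented
  on its basis of ordered monomials: the coefficient of \<open>X\<^sup>k Y\<^sup>l\<close> in \<open>f\<close> is
  \<open>lookup f (k, l)\<close>. As \<open>Y X = q\<^sup>-\<^sup>1 X Y\<close>, the product of \<open>X\<^sup>k Y\<^sup>l\<close> and \<open>X\<^sup>k' Y\<^sup>l'\<close> is
  \<open>q powi (- (l k'))\<close> times the monomial of exponent \<open>(k + k', l + l')\<close>. It is not the commutative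
  convolution product that the type of finitely supported functions carries in the library.
\<close>

type_synonym qtorus_elem = "(int \<times> int) \<Rightarrow>\<^sub>0 complex"

definition qmult :: "complex \<Rightarrow> qtorus_elem \<Rightarrow> qtorus_elem \<Rightarrow> qtorus_elem" where
  "qmult qh f g =
     (\<Sum>(k, l)\<in>Poly_Mapping.keys f. \<Sum>(k', l')\<in>Poly_Mapping.keys g.
        Poly_Mapping.single (k + k', l + l')
          ((qh\<^sup>2) powi (- (l * k')) * Poly_Mapping.lookup f (k, l) * Poly_Mapping.lookup g (k', l')))"

definition qtorus :: "complex \<Rightarrow> (complex, qtorus_elem) module" where
  "qtorus qh =
     \<lparr>carrier = UNIV, mult = qmult qh, one = Poly_Mapping.single (0, 0) 1,
      zero = 0, add = (+), smult = (\<lambda>c. Poly_Mapping.map ((*) c))\<rparr>"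

definition gen_X :: qtorus_elem where
  "gen_X = Poly_Mapping.single (1, 0) 1"

definition gen_Y :: qtorus_elem where
  "gen_Y = Poly_Mapping.single (0, 1) 1"

definition theta :: "complex \<Rightarrow> int \<times> int \<Rightarrow> qtorus_elem" where
  "theta qh = (\<lambda>(k, l).
     (qh powi (- (k * l))) \<odot>\<^bsub>qtorus qh\<^esub>
       ((gen_X [^]\<^bsub>qtorus qh\<^esub> k) \<otimes>\<^bsub>qtorus qh\<^esub> (gen_Y [^]\<^bsub>qtorus qh\<^esub> l)))"

text \<open>
  The linear map \<open>\<theta>\<^bsub>(k,l)\<^esub> \<mapsto> \<theta>\<^bsub>(k,l)A\<^esub>\<close> for \<open>A\<close> with rows \<open>(a, b)\<close> and \<open>(c, d)\<close>. The factor
  \<open>qh powi (k * l)\<close> is there because \<open>X\<^sup>k Y\<^sup>l = q\<^sup>k\<^sup>l\<^sup>/\<^sup>2 \<theta>\<^bsub>(k,l)\<^esub>\<close>.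
\<close>

definition F_plus :: "complex \<Rightarrow> int \<Rightarrow> int \<Rightarrow> int \<Rightarrow> int \<Rightarrow> qtorus_elem \<Rightarrow> qtorus_elem" where
  "F_plus qh a b c d f =
     (\<Sum>(k, l)\<in>Poly_Mapping.keys f.
        (Poly_Mapping.lookup f (k, l) * qh powi (k * l)) \<odot>\<^bsub>qtorus qh\<^esub>
          theta qh (k * a + l * c, k * b + l * d))"

text \<open>
  \<open>V\<close> is \<open>carrier_vec n\<close> with basis \<open>unit_vec n i\<close>, and endomorphisms of \<open>V\<close> are the matrices with
  respect to this basis: column \<open>j\<close> is the image of \<open>e\<^sub>j\<close>.
\<close>

abbreviation End_V :: "nat \<Rightarrow> complex mat ring" where
  "End_V n \<equiv> ring_mat TYPE(complex) n ()"

definition rho_X :: "nat \<Rightarrow> complex \<Rightarrow> complex \<Rightarrow> complex mat" where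
  "rho_X n qh u = mat n n (\<lambda>(i, j). if i = j then u * (qh\<^sup>2) ^ j else 0)"

definition rho_Y :: "nat \<Rightarrow> complex \<Rightarrow> complex mat" where
  "rho_Y n v = mat n n (\<lambda>(i, j). if i = (j + 1) mod n then v else 0)"

definition rho :: "nat \<Rightarrow> complex \<Rightarrow> complex \<Rightarrow> complex \<Rightarrow> qtorus_elem \<Rightarrow> complex mat" where
  "rho n qh u v f =
     mat n n (\<lambda>(i, j). \<Sum>(k, l)\<in>Poly_Mapping.keys f.
       Poly_Mapping.lookup f (k, l) *
         ((rho_X n qh u [^]\<^bsub>End_V n\<^esub> k) \<otimes>\<^bsub>End_V n\<^esub> (rho_Y n v [^]\<^bsub>End_V n\<^esub> l)) $$ (i, j))"

definition primitive_root_of_unity :: "nat \<Rightarrow> complex \<Rightarrow> bool" where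
  "primitive_root_of_unity n z \<longleftrightarrow> n \<ge> 1 \<and> z ^ n = 1 \<and> (\<forall>k\<in>{1..<n}. z ^ k \<noteq> 1)"

definition is_k0 :: "nat \<Rightarrow> complex \<Rightarrow> complex \<Rightarrow> complex \<Rightarrow> int \<Rightarrow> int \<Rightarrow> int \<Rightarrow> bool" where
  "is_k0 n qh u v a b k0 \<longleftrightarrow>
     (let m = gcd b (int n); n' = int n div m in
        0 \<le> k0 \<and> k0 \<le> m - 1 \<and>
        (v powi (n' * b) * u powi (n' * (a - 1)) * qh powi (a * b * n'\<^sup>2))
          * (qh\<^sup>2) powi (a * n' * k0) = 1)"

text \<open>
  A sequence indexed by the integers mod \<open>n\<close> is an \<open>n\<close>-periodic function on the integers. The
  exponent \<open>a * (2 * t * k + b * t\<^sup>2)\<close> of \<open>qh\<close> is twice the exponent \<open>a (t k + b t\<^sup>2 / 2)\<close> of \<open>q\<close>.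
  The definite descriptions are justified by \<open>ex1_k0\<close> and \<open>ex1_r_seq\<close> below.
\<close>

definition is_r_seq ::
  "nat \<Rightarrow> complex \<Rightarrow> complex \<Rightarrow> complex \<Rightarrow> int \<Rightarrow> int \<Rightarrow> (int \<Rightarrow> complex) \<Rightarrow> bool" where
  "is_r_seq n qh u v a b r \<longleftrightarrow>
     (let m = gcd b (int n); k0 = (THE k. is_k0 n qh u v a b k) in
        (\<forall>j. r (j mod int n) = r j) \<and>
        (\<forall>k\<in>{0..m - 1}. r k = (if k = k0 then 1 else 0)) \<and>
        (\<forall>k\<in>{0..m - 1}. \<forall>t.
           r (k + t * b) =
             r k * v powi (t * b) * u powi (t * (a - 1)) * qh powi (a * (2 * t * k + b * t\<^sup>2))))"

definition r_seq :: "nat \<Rightarrow> complex \<Rightarrow> complex \<Rightarrow> complex \<Rightarrow> int \<Rightarrow> int \<Rightarrow> int \<Rightarrow> complex" where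
  "r_seq n qh u v a b = (THE r. is_r_seq n qh u v a b r)"

definition Lambda_bar ::
  "nat \<Rightarrow> complex \<Rightarrow> complex \<Rightarrow> complex \<Rightarrow> int \<Rightarrow> int \<Rightarrow> int \<Rightarrow> int \<Rightarrow> complex mat" where
  "Lambda_bar n qh u v a b c d =
     mat n n (\<lambda>(k, t).
       r_seq n qh u v a b (int k - int t * d)
         * (v powi (d - 1) * u powi c) ^ t
         * qh powi (c * (2 * int t * int k - d * (int t)\<^sup>2)))"

lemma qtorus_simps [simp]:
  "carrier (qtorus qh) = UNIV" "mult (qtorus qh) = qmult qh"
  "one (qtorus qh) = Poly_Mapping.single (0, 0) 1" "zero (qtorus qh) = 0"
  "add (qtorus qh) = (+)" "smult (qtorus qh) = (\<lambda>c. Poly_Mapping.map ((*) c))"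
  by (simp_all add: qtorus_def)

lemma poly_mapping_add_induct [case_names zero single add]:
  fixes f :: "'a \<Rightarrow>\<^sub>0 'b::comm_monoid_add"
  assumes z: "P 0" and s: "\<And>m c. P (Poly_Mapping.single m c)"
    and a: "\<And>f g. P f \<Longrightarrow> P g \<Longrightarrow> P (f + g)"
  shows "P f"
proof (induction f rule: update_induct)
  case const
  then show ?case using z by (metis zero_poly_mapping_def)
next
  case (update f k c)
  have "Poly_Mapping.update k c f = f + Poly_Mapping.single k c"
    using update(1)
    by (intro poly_mapping_eqI)
       (auto simp: lookup_update lookup_add lookup_single when_def in_keys_iff)
  then show ?case using a s update by simp
qed

lemma qmult_single:
  "qmult qh (Poly_Mapping.single (k, l) x) (Poly_Mapping.single (k', l') y) =
     Poly_Mapping.single (k + k', l + l') ((qh\<^sup>2) powi (- (l * k')) * x * y)"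
  by (simp add: qmult_def)

lemma qmult_add_left: "qmult qh (f + g) h = qmult qh f h + qmult qh g h"
proof -
  define \<phi> where "\<phi> = (\<lambda>p x. \<Sum>p'\<in>Poly_Mapping.keys h.
     Poly_Mapping.single (fst p + fst p', snd p + snd p')
       ((qh\<^sup>2) powi (- (snd p * fst p')) * x * Poly_Mapping.lookup h p'))"
  have "qmult qh f h = (\<Sum>p\<in>Poly_Mapping.keys f. \<phi> p (Poly_Mapping.lookup f p))" for f
    by (simp add: qmult_def \<phi>_def case_prod_unfold)
  moreover have "(\<Sum>p\<in>Poly_Mapping.keys (f + g). \<phi> p (Poly_Mapping.lookup (f + g) p)) =
     (\<Sum>p\<in>Poly_Mapping.keys f. \<phi> p (Poly_Mapping.lookup f p)) +
     (\<Sum>p\<in>Poly_Mapping.keys g. \<phi> p (Poly_Mapping.lookup g p))"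
    by (rule setsum_keys_plus_distrib)
       (simp_all add: \<phi>_def algebra_simps single_add sum.distrib)
  ultimately show ?thesis by simp
qed

lemma qmult_add_right: "qmult qh h (f + g) = qmult qh h f + qmult qh h g"
proof -
  define \<phi> where "\<phi> = (\<lambda>p' x. \<Sum>p\<in>Poly_Mapping.keys h.
     Poly_Mapping.single (fst p + fst p', snd p + snd p')
       ((qh\<^sup>2) powi (- (snd p * fst p')) * Poly_Mapping.lookup h p * x))"
  have "qmult qh h f = (\<Sum>p\<in>Poly_Mapping.keys f. \<phi> p (Poly_Mapping.lookup f p))" for f
    unfolding qmult_def \<phi>_def case_prod_unfold by (subst sum.swap) simp
  moreover have "(\<Sum>p\<in>Poly_Mapping.keys (f + g). \<phi> p (Poly_Mapping.lookup (f + g) p)) =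
     (\<Sum>p\<in>Poly_Mapping.keys f. \<phi> p (Poly_Mapping.lookup f p)) +
     (\<Sum>p\<in>Poly_Mapping.keys g. \<phi> p (Poly_Mapping.lookup g p))"
    by (rule setsum_keys_plus_distrib)
       (simp_all add: \<phi>_def algebra_simps single_add sum.distrib)
  ultimately show ?thesis by simp
qed

lemma qmult_zero [simp]: "qmult qh 0 f = 0" "qmult qh f 0 = 0"
  by (simp_all add: qmult_def)

lemma qmult_one: "qmult qh (Poly_Mapping.single (0, 0) 1) f = f"
  "qmult qh f (Poly_Mapping.single (0, 0) 1) = f"
proof -
  show "qmult qh (Poly_Mapping.single (0, 0) 1) f = f"
    by (induction f rule: poly_mapping_add_induct)
       (auto simp: qmult_add_right qmult_single split_paired_all)
  show "qmult qh f (Poly_Mapping.single (0, 0) 1) = f"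
    by (induction f rule: poly_mapping_add_induct)
       (auto simp: qmult_add_left qmult_single split_paired_all)
qed

lemma qmult_assoc:
  assumes "qh \<noteq> 0"
  shows "qmult qh (qmult qh f g) h = qmult qh f (qmult qh g h)"
proof (induction f rule: poly_mapping_add_induct)
  case (single m c)
  show ?case
  proof (induction g rule: poly_mapping_add_induct)
    case (single m' c')
    show ?case
    proof (induction h rule: poly_mapping_add_induct)
      case (single m'' c'')
      obtain k l k' l' k'' l'' where "m = (k, l)" "m' = (k', l')" "m'' = (k'', l'')"
        by (metis surj_pair)
      moreover have "(qh\<^sup>2) powi (- ((l + l') * k'')) * (qh\<^sup>2) powi (- (l * k')) =
                     (qh\<^sup>2) powi (- (l * (k' + k''))) * (qh\<^sup>2) powi (- (l' * k''))"
        using assms by (simp flip: power_int_add add: algebra_simps)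
      ultimately show ?case
        by (simp add: qmult_single add.assoc mult_ac)
    qed (simp_all add: qmult_add_left qmult_add_right)
  qed (simp_all add: qmult_add_left qmult_add_right)
qed (simp_all add: qmult_add_left qmult_add_right)

lemma ring_qtorus:
  assumes "qh \<noteq> 0"
  shows "ring (qtorus qh)"
proof (rule ringI)
  show "abelian_group (qtorus qh)"
  proof (rule abelian_groupI)
    show "\<exists>y\<in>carrier (qtorus qh). y \<oplus>\<^bsub>qtorus qh\<^esub> x = \<zero>\<^bsub>qtorus qh\<^esub>" for x
      by (rule bexI[of _ "- x"]) auto
  qed (auto simp: add_ac)
  show "monoid (qtorus qh)"
    by (rule monoidI) (auto simp: qmult_one qmult_assoc assms)
qed (auto simp: qmult_add_left qmult_add_right)

lemma map_scale_add:
  fixes p q :: qtorus_elem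
  shows "Poly_Mapping.map ((*) x) (p + q) = Poly_Mapping.map ((*) x) p + Poly_Mapping.map ((*) x) q"
  by (rule poly_mapping_eqI) (auto simp: map.rep_eq lookup_add when_def simp flip: distrib_left)

lemma map_scale_zero: "Poly_Mapping.map ((*) (x::complex)) 0 = (0::qtorus_elem)"
  by (simp add: map_eq_zero_iff)

lemma smult_single:
  "c \<odot>\<^bsub>qtorus qh\<^esub> Poly_Mapping.single m x = Poly_Mapping.single m (c * x)"
  by simp

lemma gen_X_gen_Y:
  assumes "qh \<noteq> 0"
  shows "gen_X \<otimes>\<^bsub>qtorus qh\<^esub> gen_Y = qh\<^sup>2 \<odot>\<^bsub>qtorus qh\<^esub> (gen_Y \<otimes>\<^bsub>qtorus qh\<^esub> gen_X)"
  using assms by (simp add: gen_X_def gen_Y_def qmult_single)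

lemma int_pow_eqI:
  fixes G :: "('a, 'b) monoid_scheme" and g :: "int \<Rightarrow> 'a"
  assumes "monoid G" and car: "\<And>i. g i \<in> carrier G" and one: "g 0 = \<one>\<^bsub>G\<^esub>"
    and add: "\<And>i j. g (i + j) = g i \<otimes>\<^bsub>G\<^esub> g j"
  shows "g 1 [^]\<^bsub>G\<^esub> (k :: int) = g k"
proof -
  interpret monoid G by fact
  have nat: "g 1 [^]\<^bsub>G\<^esub> (i :: nat) = g (int i)" for i
    by (induction i) (simp_all add: one flip: add, simp add: add.commute)
  show ?thesis
  proof (cases "k < 0")
    case True
    have "inv\<^bsub>G\<^esub> (g (- k)) = g k"
      using inv_unique'[of "g (- k)" "g k"] car add[of k "- k"] add[of "- k" k] one by simp
    then show ?thesis using True nat by (simp add: int_pow_def2)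
  next
    case False
    then show ?thesis using nat by (simp add: int_pow_def2)
  qed
qed

lemma gen_monomial:
  assumes "qh \<noteq> 0"
  shows "(gen_X [^]\<^bsub>qtorus qh\<^esub> (k::int)) \<otimes>\<^bsub>qtorus qh\<^esub> (gen_Y [^]\<^bsub>qtorus qh\<^esub> (l::int))
           = Poly_Mapping.single (k, l) 1"
proof -
  interpret ring "qtorus qh" using assms by (rule ring_qtorus)
  have "gen_X [^]\<^bsub>qtorus qh\<^esub> k = Poly_Mapping.single (k, 0) 1"
    using int_pow_eqI[OF monoid_axioms, where g = "\<lambda>k. Poly_Mapping.single (k, 0) 1"]
    by (simp add: qmult_single gen_X_def)
  moreover have "gen_Y [^]\<^bsub>qtorus qh\<^esub> l = Poly_Mapping.single (0, l) 1"
    using int_pow_eqI[OF monoid_axioms, where g = "\<lambda>k. Poly_Mapping.single (0, k) 1"]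
    by (simp add: qmult_single gen_Y_def)
  ultimately show ?thesis by (simp add: qmult_single)
qed

lemma theta_eq:
  assumes "qh \<noteq> 0"
  shows "theta qh (k, l) = Poly_Mapping.single (k, l) (qh powi (- (k * l)))"
  unfolding theta_def case_prod_conv gen_monomial[OF assms] by simp

lemma F_plus_single:
  assumes "qh \<noteq> 0"
  shows "F_plus qh a b c d (Poly_Mapping.single (k, l) x) =
    Poly_Mapping.single (k * a + l * c, k * b + l * d)
      (x * qh powi (k * l - (k * a + l * c) * (k * b + l * d)))"
  using assms by (simp add: F_plus_def theta_eq power_int_diff power_int_minus divide_inverse mult.assoc)

lemma F_plus_add: 
  assumes "qh \<noteq> 0"
  shows "F_plus qh a b c d (f + g) = F_plus qh a b c d f + F_plus qh a b c d g"
proof -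
  define \<phi> where "\<phi> = (\<lambda>p x. 
     Poly_Mapping.single (fst p * a + snd p * c, fst p * b + snd p * d)
       (x * qh powi (fst p * snd p) * qh powi - ((fst p * a + snd p * c) * (fst p * b + snd p * d))))"
  have "F_plus qh a b c d f = (\<Sum>p\<in>Poly_Mapping.keys f. \<phi> p (Poly_Mapping.lookup f p))" for f
    using assms by (simp add: F_plus_def \<phi>_def theta_eq case_prod_unfold)
  moreover have "(\<Sum>p\<in>Poly_Mapping.keys (f + g). \<phi> p (Poly_Mapping.lookup (f + g) p)) =
     (\<Sum>p\<in>Poly_Mapping.keys f. \<phi> p (Poly_Mapping.lookup f p)) +
     (\<Sum>p\<in>Poly_Mapping.keys g. \<phi> p (Poly_Mapping.lookup g p))"
    by (rule setsum_keys_plus_distrib) (simp_all add: \<phi>_def distrib_right single_add)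
  ultimately show ?thesis by simp
qed

lemma F_plus_zero [simp]: "F_plus qh a b c d 0 = 0"
  by (simp add: F_plus_def)

lemma F_plus_theta:
  assumes "qh \<noteq> 0"
  shows "F_plus qh a b c d (theta qh (k, l)) = theta qh (k * a + l * c, k * b + l * d)"
  unfolding theta_eq[OF assms] F_plus_single[OF assms] using assms by (simp flip: power_int_add)

lemma F_plus_smult:
  assumes "qh \<noteq> 0"
  shows "F_plus qh a b c d (x \<odot>\<^bsub>qtorus qh\<^esub> f) = x \<odot>\<^bsub>qtorus qh\<^esub> F_plus qh a b c d f"
proof (induction f rule: poly_mapping_add_induct)
  case (single m y)
  then show ?case using assms by (cases m) (simp add: F_plus_single mult.assoc)
next
  case (add f g)
  then show ?case using assms by (simp add: F_plus_add map_scale_add)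
qed (simp add: map_scale_zero)

lemma F_plus_mult:
  assumes "qh \<noteq> 0" "a * d - b * c = 1"
  shows "F_plus qh a b c d (qmult qh f g) = qmult qh (F_plus qh a b c d f) (F_plus qh a b c d g)"
proof (induction f rule: poly_mapping_add_induct)
  case (single m x)
  show ?case
  proof (induction g rule: poly_mapping_add_induct)
    case (single m' y)
    obtain k l k' l' where m: "m = (k, l)" "m' = (k', l')" by (metis surj_pair)
    have sq: "(qh\<^sup>2) powi i = qh powi (2 * i)" for i
      using assms(1) by (simp add: power_int_mult)
    have "2 * (- (l * k')) + ((k + k') * (l + l') - ((k + k') * a + (l + l') * c) * ((k + k') * b + (l + l') * d))
      - (2 * (- ((k * b + l * d) * (k' * a + l' * c))) + (k * l - (k * a + l * c) * (k * b + l * d))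
        + (k' * l' - (k' * a + l' * c) * (k' * b + l' * d)))
      = (k * l' - l * k') * (1 - (a * d - b * c))"
      by (simp add: algebra_simps)
    then have "2 * (- (l * k')) + ((k + k') * (l + l') - ((k + k') * a + (l + l') * c) * ((k + k') * b + (l + l') * d))
      = 2 * (- ((k * b + l * d) * (k' * a + l' * c))) + (k * l - (k * a + l * c) * (k * b + l * d))
        + (k' * l' - (k' * a + l' * c) * (k' * b + l' * d))" (is "?L1 + ?L2 = ?R1 + ?R2 + ?R3")
      using assms(2) by simp
    then have "qh powi ?L1 * qh powi ?L2 = qh powi ?R1 * qh powi ?R2 * qh powi ?R3"
      using assms(1) by (simp only: power_int_add[symmetric] simp_thms)
    then have eq: "(qh powi ?L1 * x * y) * qh powi ?L2 =
        qh powi ?R1 * (x * qh powi ?R2) * (y * qh powi ?R3)"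
      by (simp add: mult_ac)
    have idx: "(k + k') * a + (l + l') * c = (k * a + l * c) + (k' * a + l' * c)"
      "(k + k') * b + (l + l') * d = (k * b + l * d) + (k' * b + l' * d)"
      by (simp_all add: algebra_simps)
    show ?case
      unfolding m qmult_single F_plus_single[OF assms(1)] sq eq by (simp only: idx)
  qed (simp_all add: F_plus_add assms(1) qmult_add_left qmult_add_right)
qed (simp_all add: F_plus_add assms(1) qmult_add_left qmult_add_right)

lemma F_plus_inverse:
  assumes "qh \<noteq> 0" "a * d - b * c = 1"
  shows "F_plus qh a b c d (F_plus qh d (- b) (- c) a f) = f"
proof (induction f rule: poly_mapping_add_induct)
  case (single m x)
  obtain k l where m: "m = (k, l)" by (metis surj_pair)
  have "(k * d + l * - c) * a + (k * - b + l * a) * c = k * (a * d - b * c)"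
    "(k * d + l * - c) * b + (k * - b + l * a) * d = l * (a * d - b * c)"
    by (simp_all add: algebra_simps)
  then have idx: "(k * d + l * - c) * a + (k * - b + l * a) * c = k"
    "(k * d + l * - c) * b + (k * - b + l * a) * d = l"
    using assms(2) by simp_all
  show ?case unfolding m F_plus_single[OF assms(1)] idx
    using assms(1) by (simp add: mult.assoc flip: power_int_add)
qed (simp_all add: F_plus_add assms(1))

lemma F_plus_automorphism:
  assumes "qh \<noteq> 0" "a * d - b * c = 1"
  shows "F_plus qh a b c d \<in> ring_hom (qtorus qh) (qtorus qh)" "bij (F_plus qh a b c d)"
proof -
  show "bij (F_plus qh a b c d)"
    by (rule o_bij[where g = "F_plus qh d (- b) (- c) a"])
       (use assms F_plus_inverse[of qh a d b c] F_plus_inverse[of qh d a "- b" "- c"]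
        in \<open>auto simp: fun_eq_iff mult.commute\<close>)
  show "F_plus qh a b c d \<in> ring_hom (qtorus qh) (qtorus qh)"
    using assms by (auto simp: ring_hom_def F_plus_mult F_plus_add F_plus_single)
qed

lemma rho_X_unit_vec:
  assumes "i < n"
  shows "rho_X n qh u *\<^sub>v unit_vec n i = (u * (qh\<^sup>2) ^ i) \<cdot>\<^sub>v unit_vec n i"
  using assms by (intro eq_vecI) (auto simp: rho_X_def)

lemma rho_Y_unit_vec:
  assumes "i < n"
  shows "rho_Y n v *\<^sub>v unit_vec n i = v \<cdot>\<^sub>v unit_vec n ((i + 1) mod n)"
  using assms by (intro eq_vecI) (auto simp: rho_Y_def)

lemma rho_X_int_pow:
  assumes "qh \<noteq> 0" "u \<noteq> 0"
  shows "rho_X n qh u [^]\<^bsub>End_V n\<^esub> (k::int) =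
    mat n n (\<lambda>(i, j). if i = j then u powi k * (qh\<^sup>2) powi (k * int j) else 0)"
proof -
  interpret ring "End_V n" by (rule ring_mat)
  define g where "g = (\<lambda>k::int. mat n n (\<lambda>(i, j). if i = j then u powi k * (qh\<^sup>2) powi (k * int j) else 0))"
  have "g 1 [^]\<^bsub>End_V n\<^esub> k = g k"
  proof (rule int_pow_eqI[OF monoid_axioms])
    show "g (k + l) = g k \<otimes>\<^bsub>End_V n\<^esub> g l" for k l
    proof (rule eq_matI)
      fix i j assume "i < dim_row (g k \<otimes>\<^bsub>End_V n\<^esub> g l)" "j < dim_col (g k \<otimes>\<^bsub>End_V n\<^esub> g l)"
      then have ij: "i < n" "j < n" by (auto simp: g_def ring_mat_simps)
      have "(g k \<otimes>\<^bsub>End_V n\<^esub> g l) $$ (i, j) = 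
        (\<Sum>s\<in>{0..<n}. (if i = s then u powi k * (qh\<^sup>2) powi (k * int s) else 0) *
           (if s = j then u powi l * (qh\<^sup>2) powi (l * int j) else 0))"
        using ij by (simp add: ring_mat_simps g_def scalar_prod_def)
      also have "\<dots> = (\<Sum>s\<in>{0..<n}. if s = i then u powi k * (qh\<^sup>2) powi (k * int s) *
           (if s = j then u powi l * (qh\<^sup>2) powi (l * int j) else 0) else 0)"
        by (rule sum.cong) auto
      also have "\<dots> = g (k + l) $$ (i, j)"
        using ij assms by (simp add: g_def power_int_add distrib_right)
      finally show "g (k + l) $$ (i, j) = (g k \<otimes>\<^bsub>End_V n\<^esub> g l) $$ (i, j)" by simp
    qed (auto simp: g_def ring_mat_simps)
    show "g 0 = \<one>\<^bsub>End_V n\<^esub>" by (auto simp: g_def ring_mat_simps)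
  qed (simp add: g_def ring_mat_simps)
  moreover have "g 1 = rho_X n qh u"
    unfolding g_def rho_X_def by (rule eq_matI) auto
  ultimately show ?thesis by (simp add: g_def)
qed

lemma int_eq_Suc_mod: "int i = (int j + 1) mod int n \<longleftrightarrow> i = (j + 1) mod n"
  by (metis of_nat_1 of_nat_add of_nat_eq_iff zmod_int)

lemma rho_Y_int_pow:
  assumes "v \<noteq> 0" "n \<ge> 1"
  shows "rho_Y n v [^]\<^bsub>End_V n\<^esub> (l::int) =
    mat n n (\<lambda>(i, j). if int i = (int j + l) mod int n then v powi l else 0)"
proof -
  interpret ring "End_V n" by (rule ring_mat)
  define g where "g = (\<lambda>l::int. mat n n (\<lambda>(i, j). if int i = (int j + l) mod int n then v powi l else 0))"
  have "g 1 [^]\<^bsub>End_V n\<^esub> l = g l"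
  proof (rule int_pow_eqI[OF monoid_axioms])
    show "g (k + l) = g k \<otimes>\<^bsub>End_V n\<^esub> g l" for k l
    proof (rule eq_matI)
      fix i j assume "i < dim_row (g k \<otimes>\<^bsub>End_V n\<^esub> g l)" "j < dim_col (g k \<otimes>\<^bsub>End_V n\<^esub> g l)"
      then have ij: "i < n" "j < n" by (auto simp: g_def ring_mat_simps)
      define s0 where "s0 = nat ((int j + l) mod int n)"
      have s0: "s0 < n" "int s0 = (int j + l) mod int n"
        using assms(2) by (auto simp: s0_def nat_less_iff)
      have "(g k \<otimes>\<^bsub>End_V n\<^esub> g l) $$ (i, j) = 
        (\<Sum>s\<in>{0..<n}. (if int i = (int s + k) mod int n then v powi k else 0) *
           (if int s = (int j + l) mod int n then v powi l else 0))"
        using ij by (simp add: ring_mat_simps g_def scalar_prod_def)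
      also have "\<dots> = (\<Sum>s\<in>{0..<n}. if s = s0 then (if int i = (int s + k) mod int n then v powi k else 0)
            * v powi l else 0)"
        by (rule sum.cong) (auto simp: s0(2)[symmetric])
      also have "\<dots> = g (k + l) $$ (i, j)"
        using ij assms s0 by (simp add: g_def power_int_add mod_simps add_ac)
      finally show "g (k + l) $$ (i, j) = (g k \<otimes>\<^bsub>End_V n\<^esub> g l) $$ (i, j)" by simp
    qed (auto simp: g_def ring_mat_simps)
    show "g 0 = \<one>\<^bsub>End_V n\<^esub>" by (auto simp: g_def ring_mat_simps)
  qed (simp add: g_def ring_mat_simps)
  moreover have "g 1 = rho_Y n v"
    unfolding g_def rho_Y_def by (rule eq_matI) (simp_all add: int_eq_Suc_mod)
  ultimately show ?thesis by (simp add: g_def)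
qed

lemma rho_monomial:
  assumes "qh \<noteq> 0" "u \<noteq> 0" "v \<noteq> 0" "n \<ge> 1"
  shows "(rho_X n qh u [^]\<^bsub>End_V n\<^esub> k) \<otimes>\<^bsub>End_V n\<^esub> (rho_Y n v [^]\<^bsub>End_V n\<^esub> l) =
    mat n n (\<lambda>(i, j). if int i = (int j + l) mod int n
      then u powi k * v powi l * (qh\<^sup>2) powi (k * int i) else 0)" (is "?L = ?R")
proof (rule eq_matI)
  fix i j assume "i < dim_row ?R" "j < dim_col ?R"
  then have ij: "i < n" "j < n" by auto
  have "?L $$ (i, j) = (\<Sum>s\<in>{0..<n}. (if i = s then u powi k * (qh\<^sup>2) powi (k * int s) else 0) *
      (if int s = (int j + l) mod int n then v powi l else 0))"
    using ij unfolding rho_X_int_pow[OF assms(1,2)] rho_Y_int_pow[OF assms(3,4)]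
    by (simp add: ring_mat_simps scalar_prod_def)
  also have "\<dots> = (\<Sum>s\<in>{0..<n}. if s = i then u powi k * (qh\<^sup>2) powi (k * int s) *
      (if int s = (int j + l) mod int n then v powi l else 0) else 0)"
    by (rule sum.cong) auto
  also have "\<dots> = ?R $$ (i, j)" using ij by simp
  finally show "?L $$ (i, j) = ?R $$ (i, j)" .
next
  show "dim_row ?L = dim_row ?R" "dim_col ?L = dim_col ?R"
    unfolding rho_X_int_pow[OF assms(1,2)] rho_Y_int_pow[OF assms(3,4)]
    by (simp_all add: ring_mat_simps)
qed

lemma rho_carrier [simp]: "rho n qh u v f \<in> carrier_mat n n"
  by (simp add: rho_def)

lemma rho_single:
  "i < n \<Longrightarrow> j < n \<Longrightarrow> rho n qh u v (Poly_Mapping.single (k, l) x) $$ (i, j) =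
     x * ((rho_X n qh u [^]\<^bsub>End_V n\<^esub> k) \<otimes>\<^bsub>End_V n\<^esub> (rho_Y n v [^]\<^bsub>End_V n\<^esub> l)) $$ (i, j)"
  by (simp add: rho_def)

lemma rho_add: "rho n qh u v (f + g) = rho n qh u v f + rho n qh u v g" (is "?L = ?R")
proof (rule eq_matI)
  fix i j assume "i < dim_row ?R" "j < dim_col ?R"
  then have ij: "i < n" "j < n" by (auto simp: rho_def)
  define \<phi> where "\<phi> = (\<lambda>(p::int \<times> int) (x::complex). x * ((rho_X n qh u [^]\<^bsub>End_V n\<^esub> fst p) \<otimes>\<^bsub>End_V n\<^esub>
      (rho_Y n v [^]\<^bsub>End_V n\<^esub> snd p)) $$ (i, j))"
  have "rho n qh u v f $$ (i, j) = (\<Sum>p\<in>Poly_Mapping.keys f. \<phi> p (Poly_Mapping.lookup f p))" for f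
    using ij by (simp add: rho_def \<phi>_def case_prod_unfold)
  moreover have "(\<Sum>p\<in>Poly_Mapping.keys (f + g). \<phi> p (Poly_Mapping.lookup (f + g) p)) =
     (\<Sum>p\<in>Poly_Mapping.keys f. \<phi> p (Poly_Mapping.lookup f p)) +
     (\<Sum>p\<in>Poly_Mapping.keys g. \<phi> p (Poly_Mapping.lookup g p))"
    by (rule setsum_keys_plus_distrib) (simp_all add: \<phi>_def distrib_right)
  ultimately show "?L $$ (i, j) = ?R $$ (i, j)"
    using ij by (simp add: index_add_mat carrier_matD[OF rho_carrier])
qed (auto simp: rho_def)

lemma rho_zero: "rho n qh u v 0 = 0\<^sub>m n n"
  by (auto simp: rho_def)

lemma rho_smult: "rho n qh u v (x \<odot>\<^bsub>qtorus qh\<^esub> f) = x \<cdot>\<^sub>m rho n qh u v f"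
proof (induction f rule: poly_mapping_add_induct)
  case (single m y)
  then show ?case
    by (cases m) (intro eq_matI, auto simp: rho_def)
next
  case (add f g)
  then show ?case
    by (simp add: rho_add map_scale_add add_smult_distrib_left_mat[OF rho_carrier rho_carrier])
qed (simp add: rho_zero map_scale_zero)

lemma rho_single_eq:
  assumes "qh \<noteq> 0" "u \<noteq> 0" "v \<noteq> 0" "n \<ge> 1"
  shows "rho n qh u v (Poly_Mapping.single (k, l) x) =
    mat n n (\<lambda>(i, j). if int i = (int j + l) mod int n
      then x * (u powi k * v powi l * (qh\<^sup>2) powi (k * int i)) else 0)"
proof (rule eq_matI)
  fix i j
  assume "i < dim_row (mat n n (\<lambda>(i, j). if int i = (int j + l) mod int n
      then x * (u powi k * v powi l * (qh\<^sup>2) powi (k * int i)) else 0))"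
    "j < dim_col (mat n n (\<lambda>(i, j). if int i = (int j + l) mod int n
      then x * (u powi k * v powi l * (qh\<^sup>2) powi (k * int i)) else 0))"
  then have ij: "i < n" "j < n" by auto
  show "rho n qh u v (Poly_Mapping.single (k, l) x) $$ (i, j) =
    mat n n (\<lambda>(i, j). if int i = (int j + l) mod int n
      then x * (u powi k * v powi l * (qh\<^sup>2) powi (k * int i)) else 0) $$ (i, j)"
    unfolding rho_single[OF ij] rho_monomial[OF assms] using ij by simp
qed (auto simp: rho_def)

lemma rho_gens:
  assumes "qh \<noteq> 0" "u \<noteq> 0" "v \<noteq> 0" "n \<ge> 1"
  shows "rho n qh u v gen_X = rho_X n qh u" "rho n qh u v gen_Y = rho_Y n v"
proof -
  show "rho n qh u v gen_X = rho_X n qh u"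
    unfolding gen_X_def rho_single_eq[OF assms] rho_X_def by (rule eq_matI) auto
  show "rho n qh u v gen_Y = rho_Y n v"
    unfolding gen_Y_def rho_single_eq[OF assms] rho_Y_def
    by (rule eq_matI) (simp_all add: int_eq_Suc_mod)
qed

lemma primitive_powi_eq_1_iff:
  assumes "primitive_root_of_unity n z"
  shows "z powi k = 1 \<longleftrightarrow> int n dvd k"
proof -
  have n: "n \<ge> 1" "z ^ n = 1" and prim: "\<And>k. 1 \<le> k \<Longrightarrow> k < n \<Longrightarrow> z ^ k \<noteq> 1"
    using assms by (auto simp: primitive_root_of_unity_def)
  then have z: "z \<noteq> 0" by (auto simp: power_0_left)
  define i where "i = nat (k mod int n)"
  have i: "i < n" "k mod int n = int i" using n(1) by (auto simp: i_def nat_less_iff)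
  have "z powi k = z powi (int n * (k div int n) + k mod int n)" by simp
  also have "\<dots> = (z powi int n) powi (k div int n) * z powi (k mod int n)"
    using z by (simp only: power_int_add power_int_mult simp_thms)
  also have "\<dots> = z ^ i" using n by (simp add: i(2))
  finally have "z powi k = z ^ i" .
  moreover have "z ^ i = 1 \<longleftrightarrow> i = 0" using prim[of i] i(1) by (cases "i = 0") auto
  moreover have "i = 0 \<longleftrightarrow> int n dvd k" using i(2) by (metis dvd_eq_mod_eq_0 of_nat_eq_0_iff)
  ultimately show ?thesis by simp
qed

lemma primitive_powi_cong:
  assumes "primitive_root_of_unity n z" "int n dvd k - l"
  shows "z powi k = z powi l"
proof -
  have "z \<noteq> 0" using assms(1) by (auto simp: primitive_root_of_unity_def power_0_left)
  then have "z powi k = z powi (k - l) * z powi l" by (simp flip: power_int_add)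
  then show ?thesis using primitive_powi_eq_1_iff[OF assms(1)] assms(2) by simp
qed

lemma rho_mult:
  assumes "u \<noteq> 0" "v \<noteq> 0" "primitive_root_of_unity n (qh\<^sup>2)"
  shows "rho n qh u v (qmult qh f g) = rho n qh u v f * rho n qh u v g"
proof -
  have n: "n \<ge> 1" and qh: "qh \<noteq> 0"
    using assms(3) by (auto simp: primitive_root_of_unity_def power_0_left)
  show ?thesis
  proof (induction f rule: poly_mapping_add_induct)
    case (single m x)
    show ?case
    proof (induction g rule: poly_mapping_add_induct)
      case (single m' y)
      obtain k l k' l' where m: "m = (k, l)" "m' = (k', l')" by (metis surj_pair)
      let ?A = "rho n qh u v (Poly_Mapping.single (k, l) x)"
      let ?B = "rho n qh u v (Poly_Mapping.single (k', l') y)"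
      let ?C = "rho n qh u v (qmult qh (Poly_Mapping.single (k, l) x) (Poly_Mapping.single (k', l') y))"
      have "?C = ?A * ?B"
      proof (rule eq_matI)
        fix i j assume "i < dim_row (?A * ?B)" "j < dim_col (?A * ?B)"
        then have ij: "i < n" "j < n" by (auto simp: rho_def)
        define s0 where "s0 = nat ((int j + l') mod int n)"
        have s0: "s0 < n" "int s0 = (int j + l') mod int n"
          using n by (auto simp: s0_def nat_less_iff)
        have "(?A * ?B) $$ (i, j) = (\<Sum>s\<in>{0..<n}.
            (if int i = (int s + l) mod int n then x * (u powi k * v powi l * (qh\<^sup>2) powi (k * int i)) else 0) *
            (if int s = (int j + l') mod int n then y * (u powi k' * v powi l' * (qh\<^sup>2) powi (k' * int s)) else 0))"
          using ij unfolding rho_single_eq[OF qh assms(1,2) n] by (simp add: scalar_prod_def)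
        also have "\<dots> = (\<Sum>s\<in>{0..<n}. if s = s0 then
            (if int i = (int s + l) mod int n then x * (u powi k * v powi l * (qh\<^sup>2) powi (k * int i)) else 0) *
            (y * (u powi k' * v powi l' * (qh\<^sup>2) powi (k' * int s))) else 0)"
          by (rule sum.cong) (auto simp: s0(2)[symmetric])
        also have "\<dots> = (if int i = (int s0 + l) mod int n then x * (u powi k * v powi l * (qh\<^sup>2) powi (k * int i)) else 0) *
            (y * (u powi k' * v powi l' * (qh\<^sup>2) powi (k' * int s0)))"
          using s0(1) by simp
        also have "\<dots> = ?C $$ (i, j)"
        proof (cases "int i = (int s0 + l) mod int n")
          case True
          then have "int n dvd int s0 + l - int i" by (simp add: mod_eq_dvd_iff[symmetric])
          then have "int n dvd k' * (int s0 + l - int i)" by (rule dvd_mult)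
          then have "(qh\<^sup>2) powi (k' * int s0) = (qh\<^sup>2) powi (k' * int i - l * k')"
            by (intro primitive_powi_cong[OF assms(3)]) (simp add: algebra_simps)
          then have q: "(qh\<^sup>2) powi (k * int i) * (qh\<^sup>2) powi (k' * int s0) =
             (qh\<^sup>2) powi (- (l * k')) * (qh\<^sup>2) powi ((k + k') * int i)"
            using qh by (simp flip: power_int_add add: algebra_simps)
          have idx: "int i = (int j + (l + l')) mod int n"
            using True s0(2) by (simp add: mod_simps add_ac)
          have "?C $$ (i, j) = (qh\<^sup>2) powi (- (l * k')) * x * y *
              (u powi (k + k') * v powi (l + l') * (qh\<^sup>2) powi ((k + k') * int i))"
            unfolding qmult_single rho_single_eq[OF qh assms(1,2) n] using ij idx by simp
          also have "\<dots> = x * y * (u powi k * u powi k') * (v powi l * v powi l') *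
              ((qh\<^sup>2) powi (- (l * k')) * (qh\<^sup>2) powi ((k + k') * int i))"
            using assms(1,2) by (simp add: power_int_add mult_ac)
          finally show ?thesis using True unfolding q[symmetric] by (simp add: mult_ac)
        next
          case False
          then have "int i \<noteq> (int j + (l + l')) mod int n"
            using s0(2) by (simp add: mod_simps add_ac)
          then show ?thesis unfolding qmult_single rho_single_eq[OF qh assms(1,2) n]
            using False ij by simp
        qed
        finally show "?C $$ (i, j) = (?A * ?B) $$ (i, j)" by simp
      qed (auto simp: rho_def)
      then show ?case unfolding m .
    next
      case (add f g)
      then show ?case
        by (simp add: qmult_add_right rho_add mult_add_distrib_mat[OF rho_carrier rho_carrier rho_carrier])
    next
      case zero
      show ?case by (simp add: rho_zero right_mult_zero_mat[OF rho_carrier])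
    qed
  next
    case (add f g)
    then show ?case
      by (simp add: qmult_add_left rho_add add_mult_distrib_mat[OF rho_carrier rho_carrier rho_carrier])
  next
    case zero
    show ?case by (simp add: rho_zero left_mult_zero_mat[OF rho_carrier])
  qed
qed

lemma rho_ring_hom:
  assumes "u \<noteq> 0" "v \<noteq> 0" "primitive_root_of_unity n (qh\<^sup>2)"
  shows "rho n qh u v \<in> ring_hom (qtorus qh) (End_V n)"
proof -
  have n: "n \<ge> 1" and qh: "qh \<noteq> 0"
    using assms(3) by (auto simp: primitive_root_of_unity_def power_0_left)
  have "rho n qh u v (Poly_Mapping.single (0, 0) 1) = 1\<^sub>m n"
    unfolding rho_single_eq[OF qh assms(1,2) n] by (rule eq_matI) auto
  then show ?thesis
    by (auto simp: ring_hom_def ring_mat_simps rho_mult[OF assms] rho_add)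
qed

context
  fixes n :: nat and qh lam1 lam2 u v :: complex and a b c d :: int
  assumes n: "n \<ge> 1" "odd n" and qh: "qh ^ n = -1" "primitive_root_of_unity n (qh\<^sup>2)"
    and det: "a * d - b * c = 1"
    and nz: "lam1 \<noteq> 0" "lam2 \<noteq> 0" and inv: "lam1 = lam1 powi a * lam2 powi b"
    and uv: "u ^ n = - lam1" "v ^ n = - lam2"
begin

lemma nonzero: "u \<noteq> 0" "v \<noteq> 0" "qh \<noteq> 0"
  using n uv nz qh by (auto simp: power_0_left)

lemma sq_powi: "(qh\<^sup>2) powi i = qh powi (2 * i)"
  by (simp add: power_int_mult)

lemma coprime_a_b: "coprime a b"
proof (rule coprimeI)
  fix x assume "x dvd a" "x dvd b"
  then have "x dvd a * d - b * c" by auto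
  then show "is_unit x" using det by simp
qed

lemma gcd_facts:
  defines "m \<equiv> gcd b (int n)"
  shows "m > 0" "int n = int n div m * m" "m dvd b" "m dvd int n" "coprime a m"
    "int n dvd b * (int n div m)" "odd (int n div m)"
proof -
  show "m > 0" using n by (simp add: m_def gcd_pos_int)
  show "m dvd b" "m dvd int n" by (simp_all add: m_def)
  then have eq: "int n div m * m = int n" by simp
  then show "int n = int n div m * m" by simp
  show "coprime a m" by (rule coprime_divisors[OF dvd_refl \<open>m dvd b\<close> coprime_a_b])
  from \<open>m dvd b\<close> obtain b' where "b = m * b'" ..
  then have "b * (int n div m) = (int n div m * m) * b'" by (simp only: mult_ac)
  then show "int n dvd b * (int n div m)" unfolding eq by simp
  show "odd (int n div m)" 
  proof
    assume "even (int n div m)"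
    then have "even (int n div m * m)" by (rule dvd_mult2)
    then show False unfolding eq using n(2) by simp
  qed
qed

lemma ex1_k0: "\<exists>!k. is_k0 n qh u v a b k"
proof -
  define m where "m = gcd b (int n)"
  define n' where "n' = int n div m"
  note f = gcd_facts[folded m_def, folded n'_def]
  define W where "W = v powi (n' * b) * u powi (n' * (a - 1)) * qh powi (a * b * n'\<^sup>2)"
  define z where "z = (qh\<^sup>2) powi (a * n')"
  have W: "W \<noteq> 0" and z: "z \<noteq> 0" using nonzero by (auto simp: W_def z_def)
  have "W powi m = v powi (n' * b * m) * u powi (n' * (a - 1) * m) * qh powi (a * b * n'\<^sup>2 * m)"
    by (simp add: W_def power_int_mult_distrib power_int_mult)
  also have "n' * b * m = int n * b" using f(2) by (simp add: mult_ac)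
  also have "n' * (a - 1) * m = int n * (a - 1)" using f(2) by (simp add: mult_ac)
  also have "a * b * n'\<^sup>2 * m = int n * (a * b * n')" using f(2) by (simp add: mult_ac power2_eq_square)
  also have "v powi (int n * b) * u powi (int n * (a - 1)) * qh powi (int n * (a * b * n')) =
     (- lam2) powi b * (- lam1) powi (a - 1) * (-1) powi (a * b * n')"
    by (simp add: power_int_mult uv qh)
  also have "\<dots> = ((- 1) * lam2) powi b * ((- 1) * lam1) powi (a - 1) * (-1) powi (a * b * n')"
    by simp
  also have "\<dots> = (lam1 powi (a - 1) * lam2 powi b) * ((-1) powi (b + (a - 1) + a * b * n'))"
    unfolding power_int_mult_distrib by (simp add: power_int_add mult_ac)
  also have "lam1 powi (a - 1) * lam2 powi b = 1"
    using inv nz by (simp add: power_int_diff)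
  also have "even (b + (a - 1) + a * b * n')"
    using coprime_a_b f(7) by (auto simp: coprime_def)
  then have "(-1 :: complex) powi (b + (a - 1) + a * b * n') = 1" by (simp add: power_int_minus_left)
  finally have Wm: "W powi m = 1" by simp
  have zk: "z powi k = 1 \<longleftrightarrow> m dvd k" for k
  proof -
    have "n' \<noteq> 0" using f(2) n by auto
    have "z powi k = (qh\<^sup>2) powi (a * n' * k)" by (simp add: z_def power_int_mult)
    then have "z powi k = 1 \<longleftrightarrow> int n dvd a * n' * k"
      using primitive_powi_eq_1_iff[OF qh(2)] by simp
    also have "\<dots> \<longleftrightarrow> n' * m dvd n' * (a * k)" using f(2) by (simp add: mult_ac)
    also have "\<dots> \<longleftrightarrow> m dvd k"
      using \<open>n' \<noteq> 0\<close> f(5) by (simp add: coprime_commute coprime_dvd_mult_right_iff)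
    finally show ?thesis .
  qed
  have inj: "k = k'" if "z powi k = z powi k'" "k \<in> {0..m - 1}" "k' \<in> {0..m - 1}" for k k'
  proof -
    have "z powi (k - k') = 1" using that z by (simp add: power_int_diff)
    then have "m dvd k - k'" using zk by simp
    then show ?thesis using that by (metis atLeastAtMost_iff mod_eq_dvd_iff mod_pos_pos_trivial zle_diff1_eq)
  qed
  define R where "R = {w::complex. w ^ nat m = 1}"
  have "card R = nat m" "finite R"
    using f(1) card_roots_unity_eq[of "nat m"] finite_roots_unity[of "nat m"] by (auto simp: R_def)
  moreover have "(\<lambda>k. z powi k) ` {0..m - 1} \<subseteq> R"
  proof
    fix w assume "w \<in> (\<lambda>k. z powi k) ` {0..m - 1}"
    then obtain k where "w = z powi k" by auto
    then have "w powi m = z powi (k * m)" by (simp add: power_int_mult)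
    also have "\<dots> = 1" using zk by simp
    finally have "w powi int (nat m) = 1" using f(1) by simp
    then show "w \<in> R" unfolding R_def by (simp only: power_int_of_nat mem_Collect_eq)
  qed
  moreover have "card ((\<lambda>k. z powi k) ` {0..m - 1}) = nat m"
    using card_image[of "\<lambda>k. z powi k" "{0..m - 1}"] inj by (auto simp: inj_on_def)
  ultimately have img: "(\<lambda>k. z powi k) ` {0..m - 1} = R"
    by (intro card_subset_eq) auto
  have "(inverse W) powi int (nat m) = 1" using f(1) Wm by (simp add: power_int_inverse)
  then have "inverse W \<in> R" unfolding R_def by (simp only: power_int_of_nat mem_Collect_eq)
  then obtain k0 where k0: "k0 \<in> {0..m - 1}" "inverse W = z powi k0" using img by auto
  have zpow: "z powi k = (qh\<^sup>2) powi (a * n' * k)" for k by (simp add: z_def power_int_mult)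
  have eq: "is_k0 n qh u v a b k \<longleftrightarrow> k \<in> {0..m - 1} \<and> W * z powi k = 1" for k
    by (auto simp: is_k0_def Let_def W_def zpow m_def n'_def)
  show ?thesis
  proof (rule ex1I[of _ k0])
    show "is_k0 n qh u v a b k0" using k0 W by (simp add: eq flip: k0(2))
    fix k assume k: "is_k0 n qh u v a b k"
    then have "z powi k = inverse W" using W by (auto simp: eq field_simps)
    then show "k = k0" using k k0 inj by (auto simp: eq)
  qed
qed

lemma ex1_r_seq: "\<exists>!r. is_r_seq n qh u v a b r"
proof -
  define m where "m = gcd b (int n)"
  define n' where "n' = int n div m"
  note f = gcd_facts[folded m_def, folded n'_def]
  define k0 where "k0 = (THE k. is_k0 n qh u v a b k)"
  have "is_k0 n qh u v a b k0" unfolding k0_def by (rule theI'[OF ex1_k0])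
  then have k0: "k0 \<in> {0..m - 1}"
    and W: "v powi (n' * b) * u powi (n' * (a - 1)) * qh powi (a * b * n'\<^sup>2) * qh powi (2 * (a * n' * k0)) = 1"
    by (auto simp: is_k0_def Let_def m_def n'_def sq_powi)
  define val where "val t = v powi (t * b) * u powi (t * (a - 1)) * qh powi (a * (2 * t * k0 + b * t\<^sup>2))"
    for t
  have per: "val (t + s * n') = val t" for t s
  proof -
    obtain e where e: "b * n' = int n * e" using f(6) by auto
    have "even (s * (s - 1))" by simp
    then obtain h where h: "s * (s - 1) = 2 * h" by (rule evenE)
    define X where "X = 2 * a * t * s * e + 2 * a * e * n' * h"
    have "a * (2 * (t + s * n') * k0 + b * (t + s * n')\<^sup>2) - a * (2 * t * k0 + b * t\<^sup>2)
       - s * (a * b * n'\<^sup>2) - s * (2 * (a * n' * k0)) = 2 * a * t * s * (b * n') + a * (b * n') * n' * (s * (s - 1))"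
      by (simp add: algebra_simps power2_eq_square)
    also have "\<dots> = int n * X" unfolding e h X_def by (simp add: algebra_simps)
    finally have D: "a * (2 * (t + s * n') * k0 + b * (t + s * n')\<^sup>2) - a * (2 * t * k0 + b * t\<^sup>2)
       - s * (a * b * n'\<^sup>2) - s * (2 * (a * n' * k0)) = int n * X" .
    have aux: "P = Q + Y * s + Z * s + V" if "P - Q - s * Y - s * Z = V" for P Q Y Z V :: int
      using that by (simp add: algebra_simps)
    have E: "a * (2 * (t + s * n') * k0 + b * (t + s * n')\<^sup>2) =
       a * (2 * t * k0 + b * t\<^sup>2) + (a * b * n'\<^sup>2) * s + (2 * (a * n' * k0)) * s + int n * X"
      using D by (rule aux)
    have pa: "v powi (x + y) = v powi x * v powi y" "u powi (x + y) = u powi x * u powi y"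
      "qh powi (x + y) = qh powi x * qh powi y" for x y
      using nonzero by (simp_all add: power_int_add)
    have i: "(t + s * n') * b = t * b + n' * b * s"
      "(t + s * n') * (a - 1) = t * (a - 1) + n' * (a - 1) * s"
      by (simp_all add: algebra_simps)
    have 1: "qh powi (int n * X) = 1"
    proof -
      have "even X" by (simp add: X_def)
      then have "(-1 :: complex) powi X = 1" by (simp add: power_int_minus_left)
      then show ?thesis by (simp add: power_int_mult qh)
    qed
    then have "val (t + s * n') = val t * (v powi (n' * b * s) * u powi (n' * (a - 1) * s)
        * qh powi ((a * b * n'\<^sup>2) * s) * qh powi ((2 * (a * n' * k0)) * s))"
      unfolding val_def E i pa 1 by (simp only: mult_ac mult_1_right mult_1_left)
    also have "\<dots> = val t * (v powi (n' * b) * u powi (n' * (a - 1)) * qh powi (a * b * n'\<^sup>2) * qh powi (2 * (a * n' * k0))) powi s"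
      by (simp only: power_int_mult power_int_mult_distrib)
    also have "\<dots> = val t" unfolding W by simp
    finally show ?thesis .
  qed
  have wd: "val t = val t'" if "int n dvd (k0 + t * b) - (k0 + t' * b)" for t t'
  proof -
    obtain b' where b': "b = m * b'" using f(3) ..
    have "coprime b' n'"
    proof (rule coprimeI)
      fix x assume "x dvd b'" "x dvd n'"
      then have "m * x dvd b" "m * x dvd int n"
        using b' f(2) by (simp_all add: mult.commute mult_dvd_mono)
      then have "m * x dvd m" unfolding m_def by (rule gcd_greatest)
      then show "is_unit x" using f(1) by simp
    qed
    have "n' * m dvd (t - t') * b' * m" using that f(2) b' by (simp add: algebra_simps)
    then have "n' dvd (t - t') * b'" using f(1) by simp
    then have "n' dvd t - t'"
      using \<open>coprime b' n'\<close> by (simp add: coprime_commute coprime_dvd_mult_left_iff)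
    then obtain s where "t - t' = n' * s" ..
    then have "t = t' + s * n'" by (simp add: algebra_simps)
    then show ?thesis using per by simp
  qed
  define r where "r j = (if \<exists>t. int n dvd j - (k0 + t * b)
     then val (SOME t. int n dvd j - (k0 + t * b)) else 0)" for j
  have r_val: "r j = val t" if "int n dvd j - (k0 + t * b)" for j t
  proof -
    define t' where "t' = (SOME t. int n dvd j - (k0 + t * b))"
    have t': "int n dvd j - (k0 + t' * b)" unfolding t'_def using that by (rule someI)
    have "int n dvd (j - (k0 + t * b)) - (j - (k0 + t' * b))" using that t' by (rule dvd_diff)
    then have "int n dvd (k0 + t' * b) - (k0 + t * b)" by (simp add: algebra_simps)
    then have "val t' = val t" by (rule wd)
    then show ?thesis using that by (auto simp: r_def simp flip: t'_def)
  qed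
  have r_0: "r (k + t * b) = 0" if "k \<in> {0..m - 1}" "k \<noteq> k0" for k t
  proof -
    have "\<not> int n dvd k + t * b - (k0 + t' * b)" for t'
    proof
      assume "int n dvd k + t * b - (k0 + t' * b)"
      then have "m dvd k + t * b - (k0 + t' * b)" using f(4) dvd_trans by blast
      moreover have "m dvd (t' - t) * b" using f(3) by simp
      ultimately have "m dvd (k + t * b - (k0 + t' * b)) + (t' - t) * b" by (rule dvd_add)
      then have "m dvd k - k0" by (simp add: algebra_simps)
      then show False
        using that k0 by (metis atLeastAtMost_iff mod_eq_dvd_iff mod_pos_pos_trivial zle_diff1_eq)
    qed
    then show ?thesis by (simp add: r_def)
  qed
  have "int n dvd j mod int n - x \<longleftrightarrow> int n dvd j - x" for j x
    by (metis mod_diff_left_eq dvd_eq_mod_eq_0)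
  then have r_per: "r (j mod int n) = r j" for j by (simp add: r_def)
  have r0: "r k0 = 1" using r_val[of k0 0] by (simp add: val_def)
  have rk: "r k = (if k = k0 then 1 else 0)" if "k \<in> {0..m - 1}" for k
    using r0 r_0[of k 0] that by auto
  have ex: "is_r_seq n qh u v a b r"
    unfolding is_r_seq_def Let_def m_def[symmetric] k0_def[symmetric]
  proof (intro conjI ballI allI)
    fix k t assume k: "k \<in> {0..m - 1}"
    show "r (k + t * b) =
      r k * v powi (t * b) * u powi (t * (a - 1)) * qh powi (a * (2 * t * k + b * t\<^sup>2))"
    proof (cases "k = k0")
      case True
      then show ?thesis using r_val[of "k0 + t * b" t] r0 by (simp add: val_def)
    next
      case False
      then show ?thesis using r_0[OF k] rk[OF k] by simp
    qed
  qed (use r_per rk in auto)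
  show ?thesis
  proof (rule ex1I[of _ r])
    show "is_r_seq n qh u v a b r" by (rule ex)
    fix r' assume r': "is_r_seq n qh u v a b r'"
    show "r' = r"
    proof
      fix j
      define k where "k = j mod m"
      have k: "k \<in> {0..m - 1}" using f(1) by (simp add: k_def)
      have "m dvd j - k" by (simp add: k_def)
      then obtain e where e: "j - k = m * e" ..
      obtain x y where "x * b + y * int n = m" unfolding m_def using bezout_int[of b "int n"] by auto
      then have "j = k + (x * b + y * int n) * e" using e by simp
      then have "j = k + (e * x) * b + (e * y) * int n" by (simp add: algebra_simps)
      then have jm: "j mod int n = (k + (e * x) * b) mod int n" by simp
      have M: "s j = s (k + (e * x) * b)" if "is_r_seq n qh u v a b s" for s
      proof -
        have "s (i mod int n) = s i" for i using that unfolding is_r_seq_def Let_def by blast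
        then show ?thesis using jm by metis
      qed
      have eq: "r' (k + (e * x) * b) = r (k + (e * x) * b)"
        using r' ex k unfolding is_r_seq_def Let_def m_def[symmetric] k0_def[symmetric] by simp
      show "r' j = r j" unfolding M[OF r'] M[OF ex] by (rule eq)
    qed
  qed
qed

lemma is_r_seq_r_seq: "is_r_seq n qh u v a b (r_seq n qh u v a b)"
  unfolding r_seq_def by (rule theI'[of "is_r_seq n qh u v a b", OF ex1_r_seq])

end

end

theory Submission
  imports Defs "Jordan_Normal_Form.Determinant"
begin

text \<open>
  Both sides of the intertwining relation \<open>\<Lambda> \<rho>(Z) = \<rho>(F(Z)) \<Lambda>\<close> are linear and multiplicative in \<open>Z\<close>, so
  the elements \<open>Z\<close> satisfying it form a subalgebra closed under inverses, and it is enough to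
  treat \<open>Z = X\<close> and \<open>Z = Y\<close>. Read entrywise, the relation for \<open>Y\<close> says how the entry of \<open>\<Lambda>\<close> at
  \<open>(k, t + 1)\<close> is obtained from the one at \<open>(k - d, t)\<close>, and the relation for \<open>X\<close> how the entry at
  \<open>(k, t)\<close> is obtained from the one at \<open>(k - b, t)\<close> (\<open>intertwines_gen_Y\<close>, \<open>intertwines_gen_X\<close>). The
  formula for the entries of \<open>\<Lambda>\<close> solves the first recursion outright; it solves the second because
  \<open>r\<close> satisfies a one-step recursion along translation by \<open>b\<close> (\<open>r_step\<close>). These computations use
  indices in the integers, which is legitimate because the formula depends on both indices
  only modulo \<open>n\<close> (\<open>L_periodic_row\<close>, \<open>L_periodic_column\<close>). The column index is where the relation
  \<open>\<lambda>\<^sub>2 = \<lambda>\<^sub>1\<^sup>c \<lambda>\<^sub>2\<^sup>d\<close> enters, together with a parity argument for the signs in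
  \<open>u\<^sup>n = - \<lambda>\<^sub>1\<close>, \<open>v\<^sup>n = - \<lambda>\<^sub>2\<close> and \<open>(q\<^sup>1\<^sup>/\<^sup>2)\<^sup>n = - 1\<close>.

  Invertibility is Schur's lemma. The representation \<open>\<rho>\<close> maps onto all matrices
  (\<open>matrix_unit_in_range_rho\<close>), and the kernel of an intertwiner is invariant under the image of \<open>\<rho>\<close>.
  A nonzero kernel would therefore contain \<open>e\<^sub>0\<close>, but the image of \<open>e\<^sub>0\<close> has the coordinates
  \<open>r\<^sub>0, \<dots>, r\<^sub>n\<^sub>-\<^sub>1\<close>, one of which is \<open>1\<close>.
\<close>

section \<open>Monomials acting on periodic matrices\<close>

text \<open>
  A monomial acts by a translation of the index combined with a diagonal factor. Extending the entries
  of a matrix periodically to the integers turns this translation into a shift of the argument,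
  without reduction modulo \<open>n\<close>.
\<close>

lemma rho_single_times_kernel:
  fixes f :: "int \<Rightarrow> int \<Rightarrow> complex"
  assumes "qh \<noteq> 0" "u \<noteq> 0" "v \<noteq> 0" "n \<ge> 1"
    and per: "\<And>i j. f (i mod int n) j = f i j"
  shows "rho n qh u v (Poly_Mapping.single (k, l) x) * mat n n (\<lambda>(i, j). f (int i) (int j)) =
    mat n n (\<lambda>(i, j). x * (u powi k * v powi l * (qh\<^sup>2) powi (k * int i)) * f (int i - l) (int j))"
    (is "?R * ?M = ?S")
proof (rule eq_matI)
  fix i j assume "i < dim_row ?S" "j < dim_col ?S"
  then have ij: "i < n" "j < n" by auto
  define s0 where "s0 = nat ((int i - l) mod int n)"
  have s0: "s0 < n" "int s0 = (int i - l) mod int n"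
    using assms(4) by (auto simp: s0_def nat_less_iff)
  have idx: "int i = (int s + l) mod int n \<longleftrightarrow> s = s0" if "s < n" for s
  proof -
    have "int i = (int s + l) mod int n \<longleftrightarrow> int i mod int n = (int s + l) mod int n"
      using ij by simp
    also have "\<dots> \<longleftrightarrow> int s mod int n = (int i - l) mod int n"
      by (auto simp: mod_eq_dvd_iff algebra_simps dvd_diff_commute)
    also have "\<dots> \<longleftrightarrow> s = s0" using that s0 by auto
    finally show ?thesis .
  qed
  have "(?R * ?M) $$ (i, j) = (\<Sum>s\<in>{0..<n}. (if int i = (int s + l) mod int n
      then x * (u powi k * v powi l * (qh\<^sup>2) powi (k * int i)) else 0) * f (int s) (int j))"
    using ij unfolding rho_single_eq[OF assms(1-4)] by (simp add: scalar_prod_def)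
  also have "\<dots> = (\<Sum>s\<in>{0..<n}. if s = s0
      then x * (u powi k * v powi l * (qh\<^sup>2) powi (k * int i)) * f (int s) (int j) else 0)"
    by (rule sum.cong) (auto simp: idx)
  also have "\<dots> = x * (u powi k * v powi l * (qh\<^sup>2) powi (k * int i)) * f (int i - l) (int j)"
    using s0 by (simp add: per)
  finally show "(?R * ?M) $$ (i, j) = ?S $$ (i, j)" using ij by simp
qed (auto simp: rho_def)

lemma kernel_times_rho_single:
  fixes f :: "int \<Rightarrow> int \<Rightarrow> complex"
  assumes "u \<noteq> 0" "v \<noteq> 0" "primitive_root_of_unity n (qh\<^sup>2)"
    and per: "\<And>i j. f i (j mod int n) = f i j"
  shows "mat n n (\<lambda>(i, j). f (int i) (int j)) * rho n qh u v (Poly_Mapping.single (k, l) x) =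
    mat n n (\<lambda>(i, j). x * (u powi k * v powi l * (qh\<^sup>2) powi (k * (int j + l))) * f (int i) (int j + l))"
    (is "?M * ?R = ?S")
proof (rule eq_matI)
  have n: "n \<ge> 1" and qh: "qh \<noteq> 0"
    using assms(3) by (auto simp: primitive_root_of_unity_def power_0_left)
  fix i j assume "i < dim_row ?S" "j < dim_col ?S"
  then have ij: "i < n" "j < n" by auto
  define s0 where "s0 = nat ((int j + l) mod int n)"
  have s0: "s0 < n" "int s0 = (int j + l) mod int n"
    using n by (auto simp: s0_def nat_less_iff)
  have "int n dvd int s0 - (int j + l)"
    by (simp add: s0(2) flip: mod_eq_dvd_iff)
  then have q: "(qh\<^sup>2) powi (k * int s0) = (qh\<^sup>2) powi (k * (int j + l))"
    by (intro primitive_powi_cong[OF assms(3)]) (simp flip: right_diff_distrib)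
  have "(?M * ?R) $$ (i, j) = (\<Sum>s\<in>{0..<n}. f (int i) (int s) * (if int s = (int j + l) mod int n
      then x * (u powi k * v powi l * (qh\<^sup>2) powi (k * int s)) else 0))"
    using ij unfolding rho_single_eq[OF qh assms(1,2) n] by (simp add: scalar_prod_def)
  also have "\<dots> = (\<Sum>s\<in>{0..<n}. if s = s0
      then x * (u powi k * v powi l * (qh\<^sup>2) powi (k * int s0)) * f (int i) (int s0) else 0)"
    by (rule sum.cong) (auto simp: s0(2)[symmetric])
  also have "\<dots> = x * (u powi k * v powi l * (qh\<^sup>2) powi (k * (int j + l))) * f (int i) (int j + l)"
    unfolding q using s0 by (simp add: per)
  finally show "(?M * ?R) $$ (i, j) = ?S $$ (i, j)" using ij by simp
qed (auto simp: rho_def)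

section \<open>Surjectivity of the representation\<close>

lemma sum_powers_root_of_unity:
  assumes "primitive_root_of_unity n z"
  shows "(\<Sum>s\<in>{0..<n}. z powi (int s * e)) = (if int n dvd e then of_nat n else 0)"
proof -
  have z: "z ^ n = 1" using assms by (simp add: primitive_root_of_unity_def)
  define w where "w = z powi e"
  have "w = 1 \<longleftrightarrow> int n dvd e" unfolding w_def by (rule primitive_powi_eq_1_iff[OF assms])
  have eq: "(\<Sum>s\<in>{0..<n}. z powi (int s * e)) = (\<Sum>s<n. w ^ s)"
    by (simp add: w_def mult.commute[of "int _" e] power_int_mult atLeast0LessThan)
  show ?thesis
  proof (cases "int n dvd e")
    case True
    then show ?thesis unfolding eq using \<open>w = 1 \<longleftrightarrow> _\<close> by simp
  next
    case False
    have "w ^ n = z powi (e * int n)" by (simp add: w_def power_int_mult)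
    also have "\<dots> = (z powi int n) powi e" by (metis mult.commute power_int_mult)
    also have "\<dots> = 1" using z by simp
    finally have "w ^ n = 1" .
    moreover have "w \<noteq> 1" using False \<open>w = 1 \<longleftrightarrow> _\<close> by simp
    ultimately show ?thesis unfolding eq using False by (simp add: geometric_sum)
  qed
qed

lemma rho_sum_entry:
  assumes "finite S" "i < n" "j < n"
  shows "rho n qh u v (\<Sum>s\<in>S. g s) $$ (i, j) = (\<Sum>s\<in>S. rho n qh u v (g s) $$ (i, j))"
  using assms(1)
proof (induction S rule: finite_induct)
  case (insert s S)
  then show ?case using assms(2,3) carrier_matD[OF rho_carrier] by (simp add: rho_add)
qed (use assms(2,3) in \<open>simp add: rho_zero\<close>)

text \<open>
  The matrix unit is \<open>v\<^sup>-\<^sup>l E Y\<^sup>l\<close> with \<open>l = i0 - j0\<close>, where \<open>E\<close> is the projection to the line spanned by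
  the basis vector of index \<open>i0\<close>. That line is an eigenspace of \<open>X\<close>, because the \<open>n\<close> eigenvalues
  \<open>u q\<^sup>i\<close> are distinct, so \<open>E\<close> is a polynomial in \<open>X\<close>: the Fourier average of the powers of \<open>u\<^sup>-\<^sup>1 X\<close>
  over \<open>s < n\<close> with weights \<open>q powi (- (s * i0))\<close>.
\<close>

lemma matrix_unit_in_range_rho:
  assumes "u \<noteq> 0" "v \<noteq> 0" "primitive_root_of_unity n (qh\<^sup>2)" "i0 < n" "j0 < n"
  obtains Z where "rho n qh u v Z = mat n n (\<lambda>(i, j). if i = i0 \<and> j = j0 then 1 else 0)"
proof
  have n: "n \<ge> 1" and qh: "qh \<noteq> 0"
    using assms(3) by (auto simp: primitive_root_of_unity_def power_0_left)
  define l where "l = int i0 - int j0"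
  define x where "x s = (qh\<^sup>2) powi (- (int s * int i0)) / (of_nat n * (u powi int s * v powi l))" for s :: nat
  define Z where "Z = (\<Sum>s\<in>{0..<n}. Poly_Mapping.single (int s, l) (x s))"
  let ?E = "mat n n (\<lambda>(i, j). if i = i0 \<and> j = j0 then 1 else 0)"
  show "rho n qh u v Z = ?E"
  proof (rule eq_matI)
    fix i j assume "i < dim_row ?E" "j < dim_col ?E"
    then have ij: "i < n" "j < n" by auto
    have scaled: "x s * (u powi int s * v powi l * (qh\<^sup>2) powi (int s * int i))
        = (qh\<^sup>2) powi (int s * (int i - int i0)) / of_nat n" for s
    proof -
      have "x s * (u powi int s * v powi l * (qh\<^sup>2) powi (int s * int i))
        = (qh\<^sup>2) powi (- (int s * int i0)) * (qh\<^sup>2) powi (int s * int i) / of_nat n"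
        using assms(1,2) by (simp add: x_def del: power_int_of_nat)
      also have "(qh\<^sup>2) powi (- (int s * int i0)) * (qh\<^sup>2) powi (int s * int i)
        = (qh\<^sup>2) powi (int s * (int i - int i0))"
        using qh by (simp flip: power_int_add add: algebra_simps)
      finally show ?thesis .
    qed
    have dvd: "int n dvd int i - int i0 \<longleftrightarrow> i = i0"
      using ij assms(4) by (simp flip: mod_eq_dvd_iff)
    have "rho n qh u v Z $$ (i, j) = (\<Sum>s\<in>{0..<n}. if int i = (int j + l) mod int n
        then x s * (u powi int s * v powi l * (qh\<^sup>2) powi (int s * int i)) else 0)"
      unfolding Z_def rho_sum_entry[OF finite_atLeastLessThan ij] rho_single_eq[OF qh assms(1,2) n]
      using ij by simp
    also have "\<dots> = (if int i = (int j + l) mod int n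
        then (\<Sum>s\<in>{0..<n}. (qh\<^sup>2) powi (int s * (int i - int i0))) / of_nat n else 0)"
      unfolding scaled by (simp add: sum_divide_distrib)
    also have "\<dots> = (if int i = (int j + l) mod int n \<and> i = i0 then 1 else 0)"
      using n unfolding sum_powers_root_of_unity[OF assms(3)] dvd by auto
    also have "int i = (int j + l) mod int n \<and> i = i0 \<longleftrightarrow> i = i0 \<and> j = j0"
    proof -
      have "int i0 = (int j + l) mod int n \<longleftrightarrow> int i0 mod int n = (int j + l) mod int n"
        using assms(4) by simp
      also have "\<dots> \<longleftrightarrow> int j0 mod int n = int j mod int n"
        unfolding mod_eq_dvd_iff l_def by (simp add: algebra_simps)
      also have "\<dots> \<longleftrightarrow> j = j0" using ij assms(5) by auto
      finally show ?thesis by auto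
    qed
    finally show "rho n qh u v Z $$ (i, j) = ?E $$ (i, j)" using ij by simp
  qed (auto simp: rho_def)
qed

section \<open>The entries of the intertwiner\<close>

text \<open>
  The entries of \<open>Lambda_bar\<close> as a function of integer indices, so that the relations between entries
  can be computed with shifts by arbitrary integers. The parameter \<open>w\<close> stands for \<open>v\<^sup>d\<^sup>-\<^sup>1 u\<^sup>c\<close>.
\<close>
definition Lambda_kernel ::
  "complex \<Rightarrow> complex \<Rightarrow> int \<Rightarrow> int \<Rightarrow> (int \<Rightarrow> complex) \<Rightarrow> int \<Rightarrow> int \<Rightarrow> complex" where
  "Lambda_kernel qh w c d r k t = r (k - t * d) * w powi t * qh powi (c * (2 * t * k - d * t\<^sup>2))"

lemma Lambda_bar_eq:
  "Lambda_bar n qh u v a b c d =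
     mat n n (\<lambda>(k, t). Lambda_kernel qh (v powi (d - 1) * u powi c) c d (r_seq n qh u v a b) (int k) (int t))"
  by (simp add: Lambda_bar_def Lambda_kernel_def)

context
  fixes n :: nat and qh lam1 lam2 u v :: complex and a b c d :: int
  assumes n: "n \<ge> 1" "odd n" and qh: "qh ^ n = -1" "primitive_root_of_unity n (qh\<^sup>2)"
    and det: "a * d - b * c = 1"
    and nz: "lam1 \<noteq> 0" "lam2 \<noteq> 0"
    and inv1: "lam1 = lam1 powi a * lam2 powi b" and inv2: "lam2 = lam1 powi c * lam2 powi d"
    and uv: "u ^ n = - lam1" "v ^ n = - lam2"
begin

abbreviation "r \<equiv> r_seq n qh u v a b"
abbreviation "w \<equiv> v powi (d - 1) * u powi c"
abbreviation "L \<equiv> Lambda_kernel qh w c d r"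
abbreviation "\<Lambda> \<equiv> Lambda_bar n qh u v a b c d"

lemmas r_props = is_r_seq_r_seq[OF n qh det nz inv1 uv]
lemmas nonzeros = nonzero[OF n qh det nz inv1 uv]

lemma r_mod: "r (j mod int n) = r j"
  using r_props unfolding is_r_seq_def Let_def by blast

lemma r_cong: "int n dvd i - j \<Longrightarrow> r i = r j"
  by (metis mod_eq_dvd_iff r_mod)

text \<open>
  The defining formula gives this on each orbit \<open>k + t b\<close>, since passing from \<open>t\<close> to \<open>t + 1\<close> raises the
  exponent of \<open>q\<close> by \<open>a (k + t b) + a b / 2\<close>, which depends on \<open>k\<close> and \<open>t\<close> only through \<open>k + t b\<close>. By
  Bezout's identity these orbits exhaust the residues modulo \<open>n\<close>.
\<close>
lemma r_step: "r (j + b) = r j * v powi b * u powi (a - 1) * qh powi (a * (2 * j + b))"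
proof -
  define m where "m = gcd b (int n)"
  have m: "m > 0" using n by (simp add: m_def gcd_pos_int)
  define k where "k = j mod m"
  have k: "k \<in> {0..m - 1}" using m by (simp add: k_def)
  have r_orbit: "r (k + t * b) = r k * v powi (t * b) * u powi (t * (a - 1)) * qh powi (a * (2 * t * k + b * t\<^sup>2))" for t
    using r_props k unfolding is_r_seq_def Let_def m_def[symmetric] by blast
  have "m dvd j - k" by (simp add: k_def)
  then obtain e where e: "j - k = m * e" ..
  obtain x y where "x * b + y * int n = m" unfolding m_def using bezout_int[of b "int n"] by auto
  then have "j = k + (x * b + y * int n) * e" using e by simp
  then have j: "j - (k + (e * x) * b) = int n * (e * y)" by (simp add: algebra_simps)
  define t where "t = e * x"
  have dvd: "int n dvd j - (k + t * b)" "int n dvd (j + b) - (k + (t + 1) * b)"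
    using j by (simp_all add: t_def algebra_simps)
  have "(qh\<^sup>2) powi (a * j) = (qh\<^sup>2) powi (a * (k + t * b))"
    by (rule primitive_powi_cong[OF qh(2)]) (use dvd(1) in \<open>simp flip: right_diff_distrib\<close>)
  then have q: "qh powi (2 * a * j) = qh powi (2 * a * (k + t * b))"
    by (simp add: power_int_mult mult.assoc)
  have pa: "v powi (x + y) = v powi x * v powi y" "u powi (x + y) = u powi x * u powi y"
      "qh powi (x + y) = qh powi x * qh powi y" for x y
    using nonzeros by (simp_all add: power_int_add)
  have ex: "(t + 1) * b = t * b + b" "(t + 1) * (a - 1) = t * (a - 1) + (a - 1)"
    "a * (2 * (t + 1) * k + b * (t + 1)\<^sup>2) = a * (2 * t * k + b * t\<^sup>2) + (2 * a * (k + t * b) + a * b)"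
    "a * (2 * j + b) = 2 * a * j + a * b"
    by (simp_all add: algebra_simps power2_eq_square)
  show ?thesis
    unfolding r_cong[OF dvd(1)] r_cong[OF dvd(2)] r_orbit unfolding ex pa q by (simp only: mult_ac)
qed

lemma L_periodic_row: "L (k mod int n) t = L k t"
proof -
  have dvd: "int n dvd (k mod int n) - k" by (simp flip: mod_eq_dvd_iff)
  then have 1: "r (k mod int n - t * d) = r (k - t * d)"
    by (intro r_cong) simp
  have "(qh\<^sup>2) powi (c * t * (k mod int n)) = (qh\<^sup>2) powi (c * t * k)"
    by (rule primitive_powi_cong[OF qh(2)]) (use dvd in \<open>simp flip: right_diff_distrib\<close>)
  then have 2: "qh powi (2 * (c * t * (k mod int n))) = qh powi (2 * (c * t * k))"
    by (simp add: power_int_mult)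
  have 3: "qh powi (c * (2 * t * i - d * t\<^sup>2)) = qh powi (2 * (c * t * i)) * qh powi (- (c * d * t\<^sup>2))" for i
    using nonzeros by (simp flip: power_int_add add: algebra_simps)
  show ?thesis unfolding Lambda_kernel_def 3 1 2 ..
qed

text \<open>
  Raising \<open>t\<close> by \<open>n\<close> multiplies \<open>w\<^sup>t\<close> by \<open>(- \<lambda>\<^sub>2)\<^sup>d\<^sup>-\<^sup>1 (- \<lambda>\<^sub>1)\<^sup>c\<close>, which is \<open>(- 1)\<^sup>d\<^sup>-\<^sup>1\<^sup>+\<^sup>c\<close> by the
  relation \<open>\<lambda>\<^sub>2 = \<lambda>\<^sub>1\<^sup>c \<lambda>\<^sub>2\<^sup>d\<close>, and the power of \<open>q\<^sup>1\<^sup>/\<^sup>2\<close> by \<open>(- 1)\<^sup>c\<^sup>d\<close>, \<open>n\<close> being odd.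
  The signs cancel because \<open>d - 1 + c + c d = (c + 1) (d + 1) - 2\<close> is even: \<open>c\<close> and \<open>d\<close> are not both even, as \<open>a d - b c = 1\<close>.
\<close>
lemma L_periodic_column: "L k (t mod int n) = L k t"
proof -
  define s where "s = - (t div int n)"
  have t: "t mod int n = t + int n * s" by (simp add: s_def minus_mult_div_eq_mod[symmetric])
  define X where "X = c * (2 * s * k - 2 * d * t * s - d * int n * s\<^sup>2)"
  have nz': "w \<noteq> 0" using nonzeros by simp
  have "w powi int n = v powi (int n * (d - 1)) * u powi (int n * c)"
    by (simp add: power_int_mult_distrib mult.commute[of "int n"] power_int_mult del: power_int_of_nat)
  also have "\<dots> = (- 1 * lam2) powi (d - 1) * (- 1 * lam1) powi c"
    by (simp add: power_int_mult uv)
  also have "\<dots> = (lam1 powi c * lam2 powi (d - 1)) * (-1) powi (d - 1 + c)"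
    unfolding power_int_mult_distrib by (simp add: power_int_add mult_ac)
  also have "lam1 powi c * lam2 powi (d - 1) = 1"
    using inv2 nz by (simp add: power_int_diff)
  finally have wn: "w powi int n = (-1) powi (d - 1 + c)" by simp
  have w: "w powi (int n * s) = (-1) powi ((d - 1 + c) * s)"
    unfolding power_int_mult wn ..
  have q: "qh powi (int n * X) = (-1) powi X" by (simp add: power_int_mult qh)
  have "odd c \<or> odd d"
  proof (rule ccontr)
    assume "\<not> (odd c \<or> odd d)"
    then have "even (a * d - b * c)" by simp
    then show False using det by simp
  qed
  then have "even ((d - 1 + c) * s + X)" using n(2) by (auto simp: X_def)
  then have sign: "(-1 :: complex) powi ((d - 1 + c) * s) * (-1) powi X = 1"
    by (simp add: power_int_minus_left flip: power_int_add)
  have ex: "c * (2 * (t + int n * s) * k - d * (t + int n * s)\<^sup>2) = c * (2 * t * k - d * t\<^sup>2) + int n * X"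
    by (simp add: X_def algebra_simps power2_eq_square)
  have "r (k - (t + int n * s) * d) = r (k - t * d)"
    by (rule r_cong) (simp add: algebra_simps)
  then have "L k (t + int n * s) = L k t * (w powi (int n * s) * qh powi (int n * X))"
    unfolding Lambda_kernel_def ex using nonzeros nz' by (simp add: power_int_add mult_ac)
  then show ?thesis unfolding t w q sign by simp
qed

section \<open>The intertwining relation\<close>

lemma intertwines_gen_X: "\<Lambda> * rho n qh u v gen_X = rho n qh u v (F_plus qh a b c d gen_X) * \<Lambda>"
proof -
  have key: "u * (qh\<^sup>2) powi t * L k t =
      qh powi (- (a * b)) * (u powi a * v powi b * (qh\<^sup>2) powi (a * k)) * L (k - b) t" for k t
  proof -
    have r: "r (k - t * d) = r (k - b - t * d) * v powi b * u powi (a - 1) * qh powi (a * (2 * (k - b - t * d) + b))"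
      using r_step[of "k - b - t * d"] by (simp add: algebra_simps)
    have u: "u powi a = u * u powi (a - 1)" using nonzeros by (simp add: power_int_diff)
    \<comment> \<open>The exponents of \<open>q\<^sup>1\<^sup>/\<^sup>2\<close> on the two sides differ by a multiple of \<open>1 - (a d - b c)\<close>.\<close>
    have "2 * t + a * (2 * (k - b - t * d) + b) + c * (2 * t * k - d * t\<^sup>2)
        - (- (a * b) + 2 * (a * k) + c * (2 * t * (k - b) - d * t\<^sup>2)) = 2 * t * (1 - (a * d - b * c))"
      by (simp add: algebra_simps power2_eq_square)
    then have "2 * t + a * (2 * (k - b - t * d) + b) + c * (2 * t * k - d * t\<^sup>2)
        = - (a * b) + 2 * (a * k) + c * (2 * t * (k - b) - d * t\<^sup>2)"
      unfolding det by simp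
    then have "qh powi (2 * t) * qh powi (a * (2 * (k - b - t * d) + b)) * qh powi (c * (2 * t * k - d * t\<^sup>2))
        = qh powi (- (a * b)) * qh powi (2 * (a * k)) * qh powi (c * (2 * t * (k - b) - d * t\<^sup>2))"
      (is "?p1 * ?p2 * ?p3 = ?s1 * ?s2 * ?s3")
      using nonzeros by (simp flip: power_int_add)
    moreover have "u * ?p1 * (r (k - b - t * d) * v powi b * u powi (a - 1) * ?p2 * w powi t * ?p3)
      = u * u powi (a - 1) * v powi b * r (k - b - t * d) * w powi t * (?p1 * ?p2 * ?p3)"
      by (simp only: mult_ac)
    ultimately have "u * ?p1 * (r (k - b - t * d) * v powi b * u powi (a - 1) * ?p2 * w powi t * ?p3)
      = ?s1 * ((u * u powi (a - 1)) * v powi b * ?s2) * (r (k - b - t * d) * w powi t * ?s3)"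
      by (simp only: mult_ac)
    then show ?thesis
      unfolding Lambda_kernel_def sq_powi[OF n qh det nz inv1 uv] r u .
  qed
  show ?thesis
    unfolding gen_X_def F_plus_single[OF nonzeros(3)] Lambda_bar_eq
      kernel_times_rho_single[where f = L, OF nonzeros(1,2) qh(2) L_periodic_column]
      rho_single_times_kernel[where f = L, OF nonzeros(3,1,2) n(1) L_periodic_row]
    by (rule eq_matI) (simp_all add: key del: power_int_of_nat)
qed

lemma intertwines_gen_Y: "\<Lambda> * rho n qh u v gen_Y = rho n qh u v (F_plus qh a b c d gen_Y) * \<Lambda>"
proof -
  have key: "v * L k (t + 1) =
      qh powi (- (c * d)) * (u powi c * v powi d * (qh\<^sup>2) powi (c * k)) * L (k - d) t" for k t
  proof -
    have r: "r (k - (t + 1) * d) = r (k - d - t * d)" by (simp add: algebra_simps)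
    have "w \<noteq> 0" using nonzeros by simp
    then have w: "w powi (t + 1) = w powi t * w" by (simp add: power_int_add)
    have vw: "v * w = u powi c * v powi d" using nonzeros by (simp add: power_int_diff)
    have "c * (2 * (t + 1) * k - d * (t + 1)\<^sup>2)
        = - (c * d) + 2 * (c * k) + c * (2 * t * (k - d) - d * t\<^sup>2)"
      by (simp add: algebra_simps power2_eq_square)
    then have q: "qh powi (c * (2 * (t + 1) * k - d * (t + 1)\<^sup>2))
        = qh powi (- (c * d)) * qh powi (2 * (c * k)) * qh powi (c * (2 * t * (k - d) - d * t\<^sup>2))"
      (is "?p = ?s1 * ?s2 * ?s3")
      using nonzeros by (simp flip: power_int_add)
    have "v * (r (k - d - t * d) * (w powi t * w) * (?s1 * ?s2 * ?s3))
      = ?s1 * (v * w * ?s2) * (r (k - d - t * d) * w powi t * ?s3)"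
      by (simp only: mult_ac)
    then show ?thesis
      unfolding Lambda_kernel_def sq_powi[OF n qh det nz inv1 uv] r w q unfolding vw .
  qed
  show ?thesis
    unfolding gen_Y_def F_plus_single[OF nonzeros(3)] Lambda_bar_eq
      kernel_times_rho_single[where f = L, OF nonzeros(1,2) qh(2) L_periodic_column]
      rho_single_times_kernel[where f = L, OF nonzeros(3,1,2) n(1) L_periodic_row]
    by (rule eq_matI) (simp_all add: key del: power_int_of_nat)
qed

lemma Lambda_carrier: "\<Lambda> \<in> carrier_mat n n"
  by (simp add: Lambda_bar_def)

abbreviation "intertwines Z \<equiv> \<Lambda> * rho n qh u v Z = rho n qh u v (F_plus qh a b c d Z) * \<Lambda>"

lemma intertwines_mult:
  assumes "intertwines Z" "intertwines Z'"
  shows "intertwines (qmult qh Z Z')"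
proof -
  let ?R = "rho n qh u v Z" and ?R' = "rho n qh u v Z'"
  let ?S = "rho n qh u v (F_plus qh a b c d Z)" and ?S' = "rho n qh u v (F_plus qh a b c d Z')"
  note assoc = assoc_mult_mat[of _ n n _ n _ n]
  have "\<Lambda> * (?R * ?R') = (\<Lambda> * ?R) * ?R'" by (simp add: assoc Lambda_carrier)
  also have "\<dots> = ?S * (\<Lambda> * ?R')" unfolding assms(1) by (simp add: assoc Lambda_carrier)
  also have "\<dots> = (?S * ?S') * \<Lambda>" unfolding assms(2) by (simp add: assoc Lambda_carrier)
  finally show ?thesis
    by (simp add: F_plus_mult[OF nonzeros(3) det] rho_mult[OF nonzeros(1,2) qh(2)])
qed

text \<open>
  With \<open>\<rho>(Z') = \<rho>(Z)\<^sup>-\<^sup>1\<close>, the relation for \<open>Z'\<close> results from multiplying the one for \<open>Z\<close> by the inverse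
  matrices on both sides.
\<close>
lemma intertwines_inverse:
  assumes "intertwines Z"
    and inv: "qmult qh Z Z' = Poly_Mapping.single (0, 0) 1" "qmult qh Z' Z = Poly_Mapping.single (0, 0) 1"
  shows "intertwines Z'"
proof -
  let ?F = "F_plus qh a b c d" and ?\<rho> = "rho n qh u v"
  note assoc = assoc_mult_mat[of _ n n _ n _ n]
  have one: "?\<rho> (Poly_Mapping.single (0, 0) 1) = 1\<^sub>m n"
    using ring_hom_one[OF rho_ring_hom[OF nonzeros(1,2) qh(2)]] by (simp add: ring_mat_simps)
  have F1: "?F (Poly_Mapping.single (0, 0) 1) = Poly_Mapping.single (0, 0) 1"
    by (simp add: F_plus_single[OF nonzeros(3)])
  have RR': "?\<rho> Z * ?\<rho> Z' = 1\<^sub>m n"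
    by (simp add: one inv(1) flip: rho_mult[OF nonzeros(1,2) qh(2)])
  have SS': "?\<rho> (?F Z') * ?\<rho> (?F Z) = 1\<^sub>m n"
    by (simp add: one F1 inv(2) flip: rho_mult[OF nonzeros(1,2) qh(2)] F_plus_mult[OF nonzeros(3) det])
  have "\<Lambda> * ?\<rho> Z' = (?\<rho> (?F Z') * ?\<rho> (?F Z)) * (\<Lambda> * ?\<rho> Z')"
    unfolding SS' by (simp add: left_mult_one_mat[OF mult_carrier_mat[OF Lambda_carrier rho_carrier]])
  also have "\<dots> = ?\<rho> (?F Z') * (?\<rho> (?F Z) * \<Lambda>) * ?\<rho> Z'" by (simp add: assoc Lambda_carrier mult_carrier_mat[of _ n n _ n])
  also have "\<dots> = ?\<rho> (?F Z') * \<Lambda> * (?\<rho> Z * ?\<rho> Z')"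
    unfolding assms(1)[symmetric] by (simp add: assoc Lambda_carrier mult_carrier_mat[of _ n n _ n])
  also have "\<dots> = ?\<rho> (?F Z') * \<Lambda>"
    unfolding RR' by (simp add: right_mult_one_mat[OF mult_carrier_mat[OF rho_carrier Lambda_carrier]])
  finally show ?thesis .
qed

text \<open>
  The condition \<open>i j = 0\<close> makes the monomial a power of \<open>X\<close> or a power of \<open>Y\<close>; its own powers
  then multiply without factors of \<open>q\<close>.
\<close>
lemma intertwines_powers:
  assumes gen: "intertwines (Poly_Mapping.single (i, j) 1)" and "i * j = 0"
  shows "intertwines (Poly_Mapping.single (s * i, s * j) 1)"
proof -
  have ij: "i = 0 \<or> j = 0" using assms(2) by simp
  have inv: "intertwines (Poly_Mapping.single (- i, - j) 1)"
    by (rule intertwines_inverse[OF gen]) (use ij in \<open>auto simp: qmult_single\<close>)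
  show ?thesis
  proof (induction s rule: int_induct[where k = 0])
    case base
    show ?case
      using intertwines_mult[OF gen inv] ij by (auto simp: qmult_single)
  next
    case (step1 s)
    show ?case
      using intertwines_mult[OF gen step1.IH] ij by (auto simp: qmult_single algebra_simps)
  next
    case (step2 s)
    show ?case
      using intertwines_mult[OF inv step2.IH] ij by (auto simp: qmult_single algebra_simps)
  qed
qed

lemma intertwines_all: "intertwines Z"
proof (induction Z rule: poly_mapping_add_induct)
  case zero
  show ?case
    by (simp add: rho_zero left_mult_zero_mat[OF Lambda_carrier] right_mult_zero_mat[OF Lambda_carrier])
next
  case (single m x)
  obtain k l where m: "m = (k, l)" by (metis surj_pair)
  have "intertwines (Poly_Mapping.single (k, 0) 1)"
    using intertwines_powers[of 1 0 k] intertwines_gen_X by (simp add: gen_X_def)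
  moreover have "intertwines (Poly_Mapping.single (0, l) 1)"
    using intertwines_powers[of 0 1 l] intertwines_gen_Y by (simp add: gen_Y_def)
  ultimately have mono: "intertwines (Poly_Mapping.single (k, l) 1)"
    using intertwines_mult[of "Poly_Mapping.single (k, 0) 1" "Poly_Mapping.single (0, l) 1"]
    by (simp add: qmult_single)
  have x: "Poly_Mapping.single m x = x \<odot>\<^bsub>qtorus qh\<^esub> Poly_Mapping.single (k, l) 1"
    unfolding smult_single m by simp
  show ?case
    unfolding x F_plus_smult[OF nonzeros(3)] rho_smult
      mult_smult_distrib[OF Lambda_carrier rho_carrier] mult_smult_assoc_mat[OF rho_carrier Lambda_carrier]
      mono ..
next
  case (add f g)
  then show ?case
    by (simp add: F_plus_add[OF nonzeros(3)] rho_add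
        mult_add_distrib_mat[OF Lambda_carrier rho_carrier rho_carrier]
        add_mult_distrib_mat[OF rho_carrier rho_carrier Lambda_carrier])
qed

section \<open>Invertibility\<close>

text \<open>The column of index \<open>0\<close> consists of the values of \<open>r\<close>, and \<open>r\<close> takes the value \<open>1\<close> at \<open>k\<^sub>0\<close>.\<close>
lemma Lambda_column_0_nonzero: obtains i where "i < n" "\<Lambda> $$ (i, 0) \<noteq> 0"
proof
  define m where "m = gcd b (int n)"
  define k0 where "k0 = (THE k. is_k0 n qh u v a b k)"
  have "is_k0 n qh u v a b k0" unfolding k0_def by (rule theI'[OF ex1_k0[OF n qh det nz inv1 uv]])
  then have k0: "k0 \<in> {0..m - 1}" by (auto simp: is_k0_def Let_def m_def)
  have "m \<le> int n" using n by (simp add: m_def zdvd_imp_le)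
  then show lt: "nat k0 < n" using k0 by auto
  have "r k0 = 1"
    using r_props k0 unfolding is_r_seq_def Let_def k0_def[symmetric] m_def[symmetric] by simp
  then show "\<Lambda> $$ (nat k0, 0) \<noteq> 0" using lt k0 n by (simp add: Lambda_bar_def)
qed

lemma Lambda_invertible: "\<Lambda> \<in> Units (End_V n)"
proof (rule det_non_zero_imp_unit[OF Lambda_carrier])
  show "Determinant.det \<Lambda> \<noteq> 0"
  proof
    assume "Determinant.det \<Lambda> = 0"
    then obtain x where x: "x \<in> carrier_vec n" "x \<noteq> 0\<^sub>v n" "\<Lambda> *\<^sub>v x = 0\<^sub>v n"
      using det_0_iff_vec_prod_zero[OF Lambda_carrier] by auto
    then obtain j where j: "j < n" "x $ j \<noteq> 0" by (metis carrier_vecD eq_vecI index_zero_vec)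
    \<comment> \<open>The matrix unit at \<open>(0, j)\<close> moves the kernel vector \<open>x\<close> to a nonzero multiple of \<open>e\<^sub>0\<close>.\<close>
    let ?E = "mat n n (\<lambda>(p, q). if p = 0 \<and> q = j then 1 else 0) :: complex mat"
    obtain Z where Z: "rho n qh u v Z = ?E"
      using matrix_unit_in_range_rho[OF nonzeros(1,2) qh(2), of 0 j] n j by auto
    have Ex: "?E *\<^sub>v x = x $ j \<cdot>\<^sub>v unit_vec n 0"
    proof (rule eq_vecI)
      fix p assume "p < dim_vec (x $ j \<cdot>\<^sub>v unit_vec n 0)"
      then have p: "p < n" by simp
      have "(?E *\<^sub>v x) $ p = (\<Sum>q\<in>{0..<n}. (if p = 0 \<and> q = j then 1 else 0) * x $ q)"
        using p x(1) by (simp add: scalar_prod_def)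
      also have "\<dots> = (\<Sum>q\<in>{0..<n}. if q = j then (if p = 0 then x $ j else 0) else 0)"
        by (rule sum.cong) auto
      finally have "(?E *\<^sub>v x) $ p = \<dots>" .
      then show "(?E *\<^sub>v x) $ p = (x $ j \<cdot>\<^sub>v unit_vec n 0) $ p"
        using p j by simp
    qed simp
    have "\<Lambda> *\<^sub>v (x $ j \<cdot>\<^sub>v unit_vec n 0) = (\<Lambda> * rho n qh u v Z) *\<^sub>v x"
      unfolding Ex[symmetric] Z[symmetric] using x(1) Lambda_carrier rho_carrier
      by (metis assoc_mult_mat_vec)
    also have "\<dots> = rho n qh u v (F_plus qh a b c d Z) *\<^sub>v (\<Lambda> *\<^sub>v x)"
      unfolding intertwines_all using x(1) Lambda_carrier rho_carrier by (metis assoc_mult_mat_vec)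
    also have "\<dots> = 0\<^sub>v n" unfolding x(3) by (simp add: mult_mat_vec_def scalar_prod_def rho_def zero_vec_def)
    finally have "\<Lambda> *\<^sub>v (x $ j \<cdot>\<^sub>v unit_vec n 0) = 0\<^sub>v n" .
    then have "x $ j \<cdot>\<^sub>v (\<Lambda> *\<^sub>v unit_vec n 0) = 0\<^sub>v n"
      using Lambda_carrier by (simp add: mult_mat_vec)
    moreover have "\<Lambda> *\<^sub>v unit_vec n 0 = col \<Lambda> 0"
      using n carrier_matD[OF Lambda_carrier] by (intro eq_vecI) simp_all
    ultimately have zero: "x $ j \<cdot>\<^sub>v col \<Lambda> 0 = 0\<^sub>v n" by simp
    obtain i where i: "i < n" "\<Lambda> $$ (i, 0) \<noteq> 0" by (rule Lambda_column_0_nonzero)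
    have "(x $ j \<cdot>\<^sub>v col \<Lambda> 0) $ i = x $ j * \<Lambda> $$ (i, 0)"
      using i n carrier_matD[OF Lambda_carrier] by simp
    then show False using zero i j by simp
  qed
qed

end

theorem lemma4p5:
  fixes n :: nat and qh lam1 lam2 u v :: complex and a b c d :: int
  assumes "n \<ge> 1" and "odd n"
    and "qh ^ n = -1" and "primitive_root_of_unity n (qh\<^sup>2)"
    and "a * d - b * c = 1"
    and "lam1 \<noteq> 0" and "lam2 \<noteq> 0"
    and "lam1 = lam1 powi a * lam2 powi b" and "lam2 = lam1 powi c * lam2 powi d"
    and "u ^ n = - lam1" and "v ^ n = - lam2"
  shows "Lambda_bar n qh u v a b c d \<in> Units (End_V n) \<and>
    (\<forall>Z\<in>carrier (qtorus qh).
       rho n qh u v (F_plus qh a b c d Z) =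
         Lambda_bar n qh u v a b c d \<otimes>\<^bsub>End_V n\<^esub> rho n qh u v Z
           \<otimes>\<^bsub>End_V n\<^esub> inv\<^bsub>End_V n\<^esub> (Lambda_bar n qh u v a b c d))"
proof (intro conjI ballI)
  interpret End: ring "End_V n" by (rule ring_mat)
  let ?L = "Lambda_bar n qh u v a b c d"
  show unit: "?L \<in> Units (End_V n)" by (rule Lambda_invertible[OF assms])
  fix Z
  let ?S = "rho n qh u v (F_plus qh a b c d Z)"
  have carrier: "rho n qh u v f \<in> carrier (End_V n)" for f by (simp add: ring_mat_simps)
  have "?L \<otimes>\<^bsub>End_V n\<^esub> rho n qh u v Z = ?S \<otimes>\<^bsub>End_V n\<^esub> ?L"
    using intertwines_all[OF assms] by (simp add: ring_mat_simps)
  then have "?L \<otimes>\<^bsub>End_V n\<^esub> rho n qh u v Z \<otimes>\<^bsub>End_V n\<^esub> inv\<^bsub>End_V n\<^esub> ?L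
      = ?S \<otimes>\<^bsub>End_V n\<^esub> (?L \<otimes>\<^bsub>End_V n\<^esub> inv\<^bsub>End_V n\<^esub> ?L)"
    using unit carrier End.Units_closed by (simp only: End.m_assoc End.Units_inv_closed)
  then show "?S = ?L \<otimes>\<^bsub>End_V n\<^esub> rho n qh u v Z \<otimes>\<^bsub>End_V n\<^esub> inv\<^bsub>End_V n\<^esub> ?L"
    using unit carrier by simp
qed

end
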